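(* Let $k\ge 2$ and $d\ge 1$ be integers, let $a_0(x),\dots,a_d(x)\in\mathbb{Z}[x]$ with $a_0(x)a_d(x)\neq 0$, and let $F(x)\in\mathbb{Z}[[x]]$ satisfy $$\sum_{i=0}^d a_i(x)F(x^{k^i})=0.$$ Let $b\ge 2$ be an integer such that $1/b$ lies inside the radius of convergence of $F(x)$. Then the irrationality exponent $\mu(F(1/b))$ is finite; that is, the Mahler number $F(1/b)$ is not a Liouville number.
   Context: For a real number $\xi$, the irrationality exponent $\mu(\xi)$ is the supremum of the real numbers $\mu$ such that $0<|\xi-p/q|<q^{-\mu}$ has infinitely many solutions $(p,q)\in\mathbb{Z}\times\mathbb{N}$. A Liouville number is a real number with infinite irrationality exponent. A number $F(1/b)$ as in the claim is called a Mahler number. No condition on the nonvanishing of $a_0((1/b)^{k^n})$ is assumed. *)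

theory Defs
  imports "HOL-Analysis.Analysis" "HOL-Computational_Algebra.Computational_Algebra"
begin

(* Pairs (p, q) are not required to be coprime; q ranges over the positive integers
   (the condition q > 0 is needed because p / 0 = 0 in HOL).  Real mu, possibly negative,
   are admitted, and the supremum is taken in the extended reals. *)
definition irrationality_exponent :: "real \<Rightarrow> ereal" where
  "irrationality_exponent \<xi> =
     (SUP \<mu> \<in> {\<mu> :: real. infinite {(p :: int, q :: nat). q > 0 \<and>
        0 < \<bar>\<xi> - of_int p / of_nat q\<bar> \<and>
        \<bar>\<xi> - of_int p / of_nat q\<bar> < of_nat q powr (- \<mu>)}}. ereal \<mu>)"

definition liouville_number :: "real \<Rightarrow> bool" where
  "liouville_number \<xi> \<longleftrightarrow> irrationality_exponent \<xi> = \<infinity>"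

(* The image of an integer power series in R[[x]], where the library's fps_conv_radius
   and eval_fps are available (int is not a normed algebra over R). *)
definition real_fps :: "int fps \<Rightarrow> real fps" where
  "real_fps F = Abs_fps (\<lambda>n. of_int (fps_nth F n))"

end

theory Submission
  imports Defs
begin

text \<open>Let \<open>y = b ^ -(k ^ n)\<close>. Iterating a Mahler system expresses a nonzero integer multiple of an
  integer linear form in the values of its solutions at \<open>1 / b\<close> as an integer linear form in the
  values at \<open>y\<close>, with
  coefficients polynomial in \<open>1 / y\<close>. Multiplying the latter form by suitable integer polynomials \<open>Q\<close>,
  chosen so that each \<open>Q * G\<close> has a long gap in its coefficients, approximates it so well by rationals
  with denominator a power of \<open>1 / y\<close> that it is either bounded below by a power of \<open>y\<close> or zero.
  The smallest admissible \<open>n\<close> gives a polynomial lower bound for the form at \<open>1 / b\<close>.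
  If \<open>a 0\<close> vanishes at some points of the orbit, differentiating the equation with the Euler operator
  expresses \<open>F (1 / b)\<close> by values of Euler derivatives of \<open>F\<close> beyond these points.\<close>

text \<open>The obstacle is that the approximating rational may vanish, and the series are not
  assumed independent over the polynomials. Vanishing is therefore made harmless: finitely many
  multipliers, fixed independently of the point and of the form, are so rich that if the truncated
  forms of all of them vanish, the exact form is zero. Everything depends on uniformity. With z =
  1/y, iteration down to y enlarges coefficients by at most z^E, where E does not depend on n
  because each step raises z to the power k >= 2. The gap length depends on E alone, so the
  multipliers can be chosen before the form is known. The values of Euler derivatives at several
  later orbit points become values at one point of the series (theta^g F)(x^(k^i)), theta = x d/dx.
  Together with the constant series 1, which turns an approximation p/q into a linear form, they
  satisfy a Mahler system whose denominator is a power of \<open>a 0\<close>. Its finitely many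
  zeros on the orbit lie before the new base point.\<close>

section \<open>Linear algebra: finite rank and integral duality\<close>

text \<open>Infinitely many rows of finite length span a finite-dimensional space, so finitely many
  of them have the same kernel. The induction is Gaussian elimination of one column at a
  time.\<close>

lemma finite_row_rank:
  fixes t :: "nat \<Rightarrow> 'c \<Rightarrow> real"
  assumes "finite A"
  shows "\<exists>L. \<forall>c. (\<forall>i<L. (\<Sum>a\<in>A. t i a * c a) = 0) \<longrightarrow> (\<forall>i. (\<Sum>a\<in>A. t i a * c a) = 0)"
  using assms
proof (induction A arbitrary: t rule: finite_induct)
  case empty
  then show ?case by simp
next
  case (insert a A)
  show ?case
  proof (cases "\<forall>i. t i a = 0")
    case True
    then show ?thesis using insert.IH[of t] insert.hyps by simp
  next
    case False
    then obtain i0 where i0: "t i0 a \<noteq> 0" by auto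
    \<comment> \<open>The pivot row \<open>i0\<close> clears column \<open>a\<close>; it must itself
      be among the tested rows, whence the bound \<open>max L (Suc i0)\<close> below.\<close>
    define t' where "t' = (\<lambda>i x. t i x - t i a / t i0 a * t i0 x)"
    obtain L where L: "\<And>c. (\<forall>i<L. (\<Sum>x\<in>A. t' i x * c x) = 0) \<Longrightarrow> (\<forall>i. (\<Sum>x\<in>A. t' i x * c x) = 0)"
      using insert.IH[of t'] by blast
    have red: "(\<Sum>x\<in>A. t' i x * c x) =
        (\<Sum>x\<in>insert a A. t i x * c x) - t i a / t i0 a * (\<Sum>x\<in>insert a A. t i0 x * c x)" for i c
    proof -
      have "(\<Sum>x\<in>A. t' i x * c x) = (\<Sum>x\<in>A. t i x * c x) - t i a / t i0 a * (\<Sum>x\<in>A. t i0 x * c x)"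
        by (simp add: t'_def sum_subtractf sum_distrib_left algebra_simps)
      with insert.hyps i0 show ?thesis by (simp add: algebra_simps)
    qed
    show ?thesis
    proof (intro exI[of _ "max L (Suc i0)"] allI impI)
      fix c i
      assume z: "\<forall>i<max L (Suc i0). (\<Sum>x\<in>insert a A. t i x * c x) = 0"
      then have z0: "(\<Sum>x\<in>insert a A. t i0 x * c x) = 0" by simp
      have "\<forall>i<L. (\<Sum>x\<in>A. t' i x * c x) = 0"
        using z z0 unfolding red by simp
      then have "(\<Sum>x\<in>A. t' i x * c x) = 0" using L by blast
      then show "(\<Sum>x\<in>insert a A. t i x * c x) = 0"
        unfolding red z0 by simp
    qed
  qed
qed

text \<open>Scaling is written as multiplication by \<open>of_int c\<close>, so that one predicate
  serves functionals on integer polynomials with values in the integers and in the reals.\<close>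

definition int_linear :: "('v::ring_1 \<Rightarrow> 'w::ring_1) \<Rightarrow> bool" where
  "int_linear f \<longleftrightarrow> (\<forall>x y. f (x + y) = f x + f y) \<and> (\<forall>c x. f (of_int c * x) = of_int c * f x)"

lemma int_linear_add: "int_linear f \<Longrightarrow> f (x + y) = f x + f y"
  and int_linear_scale: "int_linear f \<Longrightarrow> f (of_int c * x) = of_int c * f x"
  by (auto simp: int_linear_def)

lemma int_linear_diff:
  assumes "int_linear f"
  shows "f (x - y) = f x - f y"
  using int_linear_add[OF assms, of "x - y" y] by simp

text \<open>Over the integers, linear functionals that vanish on the common kernel of finitely many
  functionals are combinations of these. The clause about \<open>f\<close> says, without naming spans, that
  \<open>B'\<close> lies in the span of \<open>B\<close>.\<close>

lemma int_kernel_dual: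
  fixes \<phi> :: "'p \<Rightarrow> 'v::ring_1 \<Rightarrow> int"
  assumes "finite P" "finite B" "\<forall>p\<in>P. int_linear (\<phi> p)"
  shows "\<exists>B'. finite B' \<and> (\<forall>Q\<in>B'. \<forall>p\<in>P. \<phi> p Q = 0) \<and>
     (\<forall>f::'v \<Rightarrow> int. int_linear f \<longrightarrow> (\<forall>Q\<in>B. f Q = 0) \<longrightarrow> (\<forall>Q\<in>B'. f Q = 0)) \<and>
     (\<forall>\<psi>::'v \<Rightarrow> real. int_linear \<psi> \<longrightarrow> (\<forall>Q\<in>B'. \<psi> Q = 0) \<longrightarrow>
        (\<exists>c. \<forall>Q\<in>B. \<psi> Q = (\<Sum>p\<in>P. c p * of_int (\<phi> p Q))))"
  using assms
proof (induction P arbitrary: B rule: finite_induct)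
  case empty
  then show ?case by (intro exI[of _ B]) auto
next
  case (insert p P)
  have linP: "\<forall>q\<in>P. int_linear (\<phi> q)" and lin: "int_linear (\<phi> p)"
    using insert.prems(2) by auto
  show ?case
  proof (cases "\<forall>Q\<in>B. \<phi> p Q = 0")
    case True
    obtain B' where B': "finite B'" "\<forall>Q\<in>B'. \<forall>p\<in>P. \<phi> p Q = 0"
     "\<forall>f::'v \<Rightarrow> int. int_linear f \<longrightarrow> (\<forall>Q\<in>B. f Q = 0) \<longrightarrow> (\<forall>Q\<in>B'. f Q = 0)"
     "\<forall>\<psi>::'v \<Rightarrow> real. int_linear \<psi> \<longrightarrow> (\<forall>Q\<in>B'. \<psi> Q = 0) \<longrightarrow>
        (\<exists>c. \<forall>Q\<in>B. \<psi> Q = (\<Sum>p\<in>P. c p * of_int (\<phi> p Q)))"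
      using insert.IH[OF insert.prems(1) linP]
      by (elim exE conjE) (rule that)
    show ?thesis
    proof (intro exI[of _ B'] conjI)
      have "\<forall>Q\<in>B'. \<phi> p Q = 0"
        using B'(3)[rule_format, of "\<phi> p"] lin True by blast
      then show "\<forall>Q\<in>B'. \<forall>p\<in>insert p P. \<phi> p Q = 0"
        using B'(2) by blast
      show "\<forall>\<psi>::'v \<Rightarrow> real. int_linear \<psi> \<longrightarrow> (\<forall>Q\<in>B'. \<psi> Q = 0) \<longrightarrow>
        (\<exists>c. \<forall>Q\<in>B. \<psi> Q = (\<Sum>p\<in>insert p P. c p * of_int (\<phi> p Q)))"
        using B'(4) True insert.hyps by simp
    qed (fact B'(1), fact B'(3))
  next
    case False
    then obtain Q0 where Q0: "Q0 \<in> B" "\<phi> p Q0 \<noteq> 0" by auto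
    define e where "e = (\<lambda>Q. of_int (\<phi> p Q0) * Q - of_int (\<phi> p Q) * Q0)"
    have e_app: "f (e Q) = of_int (\<phi> p Q0) * f Q - of_int (\<phi> p Q) * f Q0"
      if "int_linear f" for f :: "'v \<Rightarrow> 'w::ring_1" and Q
      by (simp add: e_def int_linear_diff[OF that] int_linear_scale[OF that])
    obtain B' where B': "finite B'" "\<forall>Q\<in>B'. \<forall>p\<in>P. \<phi> p Q = 0"
     "\<forall>f::'v \<Rightarrow> int. int_linear f \<longrightarrow> (\<forall>Q\<in>e ` B. f Q = 0) \<longrightarrow> (\<forall>Q\<in>B'. f Q = 0)"
     "\<forall>\<psi>::'v \<Rightarrow> real. int_linear \<psi> \<longrightarrow> (\<forall>Q\<in>B'. \<psi> Q = 0) \<longrightarrow>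
        (\<exists>c. \<forall>Q\<in>e ` B. \<psi> Q = (\<Sum>p\<in>P. c p * of_int (\<phi> p Q)))"
      using insert.IH[OF finite_imageI[OF insert.prems(1), of e] linP]
      by (elim exE conjE) (rule that)
    show ?thesis
    proof (intro exI[of _ B'] conjI allI impI)
      have "\<forall>Q\<in>e ` B. \<phi> p Q = 0"
        using lin by (simp add: e_app)
      then have "\<forall>Q\<in>B'. \<phi> p Q = 0"
        using B'(3)[rule_format, of "\<phi> p"] lin by blast
      then show "\<forall>Q\<in>B'. \<forall>p\<in>insert p P. \<phi> p Q = 0"
        using B'(2) by blast
    next
      fix f :: "'v \<Rightarrow> int"
      assume f: "int_linear f" "\<forall>Q\<in>B. f Q = 0"
      then have "\<forall>Q\<in>e ` B. f Q = 0" using Q0 by (simp add: e_app)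
      then show "\<forall>Q\<in>B'. f Q = 0" using B'(3) f by blast
    next
      fix \<psi> :: "'v \<Rightarrow> real"
      assume psi: "int_linear \<psi>" "\<forall>Q\<in>B'. \<psi> Q = 0"
      then obtain c where c: "\<forall>Q\<in>e ` B. \<psi> Q = (\<Sum>p\<in>P. c p * of_int (\<phi> p Q))"
        using B'(4) by blast
      \<comment> \<open>What \<open>P\<close> leaves of \<open>\<psi>\<close> vanishes on every
        \<open>e Q\<close>; on \<open>B\<close> it is therefore a multiple of
        \<open>\<phi> p\<close>, with the factor read off at \<open>Q0\<close>.\<close>
      define \<rho> where "\<rho> = (\<lambda>Q. \<psi> Q - (\<Sum>p\<in>P. c p * of_int (\<phi> p Q)))"
      have chi: "int_linear \<rho>"
        unfolding int_linear_def
      proof (intro conjI allI)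
        fix x y
        have "(\<Sum>p\<in>P. c p * of_int (\<phi> p (x + y))) =
            (\<Sum>p\<in>P. c p * of_int (\<phi> p x)) + (\<Sum>p\<in>P. c p * of_int (\<phi> p y))"
          unfolding sum.distrib[symmetric]
          by (intro sum.cong refl) (simp add: int_linear_add[OF linP[rule_format]] distrib_left)
        then show "\<rho> (x + y) = \<rho> x + \<rho> y"
          by (simp add: \<rho>_def int_linear_add[OF psi(1)])
      next
        fix m x
        have "(\<Sum>p\<in>P. c p * of_int (\<phi> p (of_int m * x))) =
            of_int m * (\<Sum>p\<in>P. c p * of_int (\<phi> p x))"
          unfolding sum_distrib_left
          by (intro sum.cong refl) (simp add: int_linear_scale[OF linP[rule_format]])
        then show "\<rho> (of_int m * x) = of_int m * \<rho> x"
          by (simp add: \<rho>_def int_linear_scale[OF psi(1)] right_diff_distrib)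
      qed
      define c' where "c' = c(p := \<rho> Q0 / \<phi> p Q0)"
      have "\<psi> Q = (\<Sum>p\<in>insert p P. c' p * of_int (\<phi> p Q))" if "Q \<in> B" for Q
      proof -
        have "\<rho> (e Q) = 0" using c that by (simp add: \<rho>_def)
        then have "\<rho> Q = \<rho> Q0 / \<phi> p Q0 * \<phi> p Q"
          using Q0 by (simp add: e_app[OF chi] field_simps)
        moreover have "(\<Sum>p\<in>insert p P. c' p * of_int (\<phi> p Q)) =
            \<rho> Q0 / \<phi> p Q0 * \<phi> p Q + (\<Sum>p\<in>P. c p * of_int (\<phi> p Q))"
          using insert.hyps by (auto simp: c'_def intro!: sum.cong)
        ultimately show ?thesis by (simp add: \<rho>_def)
      qed
      then show "\<exists>c. \<forall>Q\<in>B. \<psi> Q = (\<Sum>p\<in>insert p P. c p * of_int (\<phi> p Q))" by blast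
    qed (fact B'(1))
  qed
qed

section \<open>Integer power series as real power series: algebra, radius and evaluation\<close>

lemma real_fps_nth [simp]: "fps_nth (real_fps F) n = of_int (fps_nth F n)"
  by (simp add: real_fps_def)

lemma real_fps_mult: "real_fps (f * g) = real_fps f * real_fps g"
  by (rule fps_ext) (simp add: fps_mult_nth)

lemma real_fps_sum: "real_fps (\<Sum>i\<in>A. f i) = (\<Sum>i\<in>A. real_fps (f i))"
  by (rule fps_ext) (simp add: fps_sum_nth)

lemma real_fps_of_poly: "real_fps (fps_of_poly p) = fps_of_poly (map_poly of_int p)"
  by (rule fps_ext) (simp add: coeff_map_poly)

lemma less_fps_conv_radius_mult:
  assumes "r < fps_conv_radius f" "r < fps_conv_radius g"
  shows "r < fps_conv_radius (f * g)"
  using fps_conv_radius_mult[of f g] assms by (meson less_le_trans min_less_iff_conj)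

lemma less_fps_conv_radius_diff:
  assumes "r < fps_conv_radius f" "r < fps_conv_radius g"
  shows "r < fps_conv_radius (f - g)"
  using fps_conv_radius_diff[of f g] assms by (meson less_le_trans min_less_iff_conj)

lemma less_fps_conv_radius_sum:
  assumes "\<And>i. i \<in> A \<Longrightarrow> r < fps_conv_radius (f i)" "r < \<infinity>"
  shows "r < fps_conv_radius (\<Sum>i\<in>A. f i)"
  using assms
proof (induction A rule: infinite_finite_induct)
  case (insert i A)
  then have "r < min (fps_conv_radius (f i)) (fps_conv_radius (\<Sum>i\<in>A. f i))" by simp
  also have "\<dots> \<le> fps_conv_radius (f i + (\<Sum>i\<in>A. f i))" by (rule fps_conv_radius_add)
  finally show ?case using insert.hyps by simp
qed auto

lemma eval_fps_sum:
  assumes "\<And>i. i \<in> A \<Longrightarrow> ereal (norm z) < fps_conv_radius (f i)"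
  shows "eval_fps (\<Sum>i\<in>A. f i) z = (\<Sum>i\<in>A. eval_fps (f i) z)"
  using assms
proof (induction A rule: infinite_finite_induct)
  case (insert i A)
  then have "ereal (norm z) < fps_conv_radius (\<Sum>i\<in>A. f i)"
    by (intro less_fps_conv_radius_sum) auto
  then have "eval_fps (f i + (\<Sum>i\<in>A. f i)) z = eval_fps (f i) z + eval_fps (\<Sum>i\<in>A. f i) z"
    using insert.prems by (intro eval_fps_add) auto
  with insert show ?case by simp
qed auto

section \<open>Multipliers that create gaps and detect vanishing forms\<close>

lemma fps_of_poly_monom_mult_nth:
  fixes f :: "'a::comm_ring_1 fps"
  shows "fps_nth (fps_of_poly (monom 1 j) * f) i = (if j \<le> i then fps_nth f (i - j) else 0)"
  by (simp add: fps_of_poly_monom' fps_X_power_mult_nth)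

lemma fps_X_minus_const_mult_nth:
  fixes f :: "'a::comm_ring_1 fps"
  shows "fps_nth ((fps_X - fps_const y) * f) n = (if n = 0 then 0 else fps_nth f (n - 1)) - y * fps_nth f n"
  by (simp add: left_diff_distrib fps_X_mult_nth)

text \<open>This replaces a zero estimate. If the truncated forms of all \<open>Q \<in> B\<close> vanish, duality gives a
  combination \<open>S = (\<Sum>g. E g * G g)\<close> with a gap in its coefficients such that
  \<open>(x - y) * S - x ^ L * (\<Sum>g. \<mu> g * G g)\<close> is a combination of the \<open>G g\<close> with polynomial coefficients of
  degree less than \<open>\<sigma>\<close>. By the choice of \<open>D\<close> the gap forces the latter to be a polynomial, whose
  value at \<open>y\<close> telescopes to zero.\<close>

lemma gap_polynomials_detect_zero:
  fixes G :: "'i \<Rightarrow> int fps"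
  assumes I: "finite I" and \<sigma>: "\<sigma> \<ge> 1"
  shows "\<exists>D B. finite B \<and>
     (\<forall>Q\<in>B. \<forall>g\<in>I. \<forall>i. D < i \<and> i < D + \<sigma> \<longrightarrow> fps_nth (fps_of_poly Q * G g) i = 0) \<and>
     (\<forall>y \<mu>. 0 < y \<longrightarrow> (\<forall>g\<in>I. ereal y < fps_conv_radius (real_fps (G g))) \<longrightarrow>
        (\<forall>Q\<in>B. (\<Sum>g\<in>I. \<mu> g * (\<Sum>i\<le>D. y ^ i * of_int (fps_nth (fps_of_poly Q * G g) i))) = 0) \<longrightarrow>
        (\<Sum>g\<in>I. \<mu> g * eval_fps (real_fps (G g)) y) = 0)"
proof -
  define R where "R = (\<lambda>g. real_fps (G g))"
  \<comment> \<open>Row \<open>i\<close> gives the coefficient of index \<open>i + \<sigma>\<close>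
    in a combination of the series whose polynomial coefficients have degree less than
    \<open>\<sigma>\<close>. Thus if the \<open>D\<close> coefficients from index
    \<open>\<sigma>\<close> on vanish, all later ones do.\<close>
  define t where "t = (\<lambda>i (g, j). fps_nth (R g) (i + \<sigma> - j))"
  obtain D where D: "\<And>c. (\<forall>i<D. (\<Sum>a\<in>I \<times> {..<\<sigma>}. t i a * c a) = 0) \<Longrightarrow>
      (\<forall>i. (\<Sum>a\<in>I \<times> {..<\<sigma>}. t i a * c a) = 0)"
    using finite_row_rank[of "I \<times> {..<\<sigma>}" t] I by auto
  define L where "L = D + \<sigma>"
  define \<phi> where "\<phi> = (\<lambda>(g, i) Q. fps_nth (fps_of_poly Q * G g) i)"
  define P where "P = I \<times> {D<..<L}"
  \<comment> \<open>The \<open>D + 1\<close> shifts by these monomials later supply exactly the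
    vanishing coefficients of \<open>S\<close> at the indices from \<open>\<sigma> - 1\<close> to
    \<open>L - 1\<close>.\<close>
  define B0 where "B0 = (\<lambda>j. monom (1::int) j) ` {..D}"
  have of_int_mult: "of_int c * p = smult c p" for c :: int and p :: "int poly"
    by (simp add: of_int_poly)
  have lin: "int_linear (\<phi> p)" for p
    by (cases p) (simp add: int_linear_def \<phi>_def of_int_mult fps_of_poly_add fps_of_poly_smult
       distrib_right mult.assoc)
  have "\<exists>B'. finite B' \<and> (\<forall>Q\<in>B'. \<forall>p\<in>P. \<phi> p Q = 0) \<and>
     (\<forall>f::int poly \<Rightarrow> int. int_linear f \<longrightarrow> (\<forall>Q\<in>B0. f Q = 0) \<longrightarrow> (\<forall>Q\<in>B'. f Q = 0)) \<and>
     (\<forall>\<psi>::int poly \<Rightarrow> real. int_linear \<psi> \<longrightarrow> (\<forall>Q\<in>B'. \<psi> Q = 0) \<longrightarrow>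
        (\<exists>c. \<forall>Q\<in>B0. \<psi> Q = (\<Sum>p\<in>P. c p * of_int (\<phi> p Q))))"
    by (rule int_kernel_dual) (use I lin in \<open>simp_all add: P_def B0_def\<close>)
  then obtain B where B: "finite B" "\<forall>Q\<in>B. \<forall>p\<in>P. \<phi> p Q = 0"
     and dual: "\<forall>\<psi>::int poly \<Rightarrow> real. int_linear \<psi> \<longrightarrow> (\<forall>Q\<in>B. \<psi> Q = 0) \<longrightarrow>
        (\<exists>c. \<forall>Q\<in>B0. \<psi> Q = (\<Sum>p\<in>P. c p * of_int (\<phi> p Q)))"
    by (elim exE conjE) (rule that)
  have zero: "(\<Sum>g\<in>I. \<mu> g * eval_fps (R g) y) = 0"
    if y: "0 < y" and rad: "\<And>g. g \<in> I \<Longrightarrow> ereal y < fps_conv_radius (R g)"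
      and van: "\<forall>Q\<in>B. (\<Sum>g\<in>I. \<mu> g * (\<Sum>i\<le>D. y ^ i * of_int (fps_nth (fps_of_poly Q * G g) i))) = 0"
    for y \<mu>
  proof -
    define \<psi> where "\<psi> = (\<lambda>Q. \<Sum>g\<in>I. \<mu> g * (\<Sum>i\<le>D. y ^ i * of_int (\<phi> (g, i) Q)))"
    have "int_linear \<psi>"
      unfolding int_linear_def \<psi>_def
      by (simp only: int_linear_add[OF lin] int_linear_scale[OF lin])
        (simp add: sum.distrib sum_distrib_left distrib_left mult_ac)
    moreover have "\<forall>Q\<in>B. \<psi> Q = 0" using van by (simp add: \<psi>_def \<phi>_def)
    ultimately obtain c where "\<forall>Q\<in>B0. \<psi> Q = (\<Sum>p\<in>P. c p * of_int (\<phi> p Q))"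
      using dual[THEN spec, THEN mp, THEN mp, of \<psi>] by blast
    then have c: "\<psi> (monom 1 j) = (\<Sum>p\<in>P. c p * of_int (\<phi> p (monom 1 j)))" if "j \<le> D" for j
      using that by (simp add: B0_def)
    \<comment> \<open>The truncated form and the gap functionals from duality are merged into one
      functional on the first \<open>L\<close> coefficients, which kills every shift by
      \<open>monom 1 j\<close> with \<open>j \<le> D\<close>.\<close>
    define e where "e = (\<lambda>g i. if i \<le> D then \<mu> g * y ^ i else - c (g, i))"
    have rel: "(\<Sum>g\<in>I. \<Sum>i<L. e g i * of_int (\<phi> (g, i) (monom 1 j))) = 0" if "j \<le> D" for j
    proof -
      have split: "{..<L} = {..D} \<union> {D<..<L}" using \<sigma> by (auto simp: L_def)
      have "(\<Sum>i<L. e g i * of_int (\<phi> (g, i) (monom 1 j))) =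
          \<mu> g * (\<Sum>i\<le>D. y ^ i * of_int (\<phi> (g, i) (monom 1 j)))
          - (\<Sum>i\<in>{D<..<L}. c (g, i) * of_int (\<phi> (g, i) (monom 1 j)))" for g
      proof -
        have "(\<Sum>i<L. e g i * of_int (\<phi> (g, i) (monom 1 j))) =
            (\<Sum>i\<le>D. e g i * of_int (\<phi> (g, i) (monom 1 j))) +
            (\<Sum>i\<in>{D<..<L}. e g i * of_int (\<phi> (g, i) (monom 1 j)))"
          unfolding split by (rule sum.union_disjoint) auto
        then show ?thesis
          by (simp add: e_def sum_distrib_left sum_negf mult.assoc)
      qed
      then show ?thesis
        using c[OF that] by (simp add: \<psi>_def P_def sum_subtractf sum.cartesian_product)
    qed
    \<comment> \<open>Reversing the order of the coefficients turns a pairing with the shift by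
      \<open>j\<close> into the coefficient of index \<open>L - 1 - j\<close> of a product.\<close>
    define E where "E = (\<lambda>g. Abs_poly (\<lambda>n. if n \<le> L - 1 then e g (L - 1 - n) else 0))"
    have E: "coeff (E g) n = (if n \<le> L - 1 then e g (L - 1 - n) else 0)" for g n
      unfolding E_def coeff_Abs_poly_If_le ..
    have L: "L \<ge> 1" "L \<ge> \<sigma>" using \<sigma> by (simp_all add: L_def)
    define S where "S = (\<Sum>g\<in>I. fps_of_poly (E g) * R g)"
    have S0: "fps_nth S n = 0" if n: "\<sigma> - 1 \<le> n" "n < L" for n
    proof -
      define j where "j = L - 1 - n"
      have j: "j \<le> D" "n = L - 1 - j" "j < L" using n \<sigma> by (auto simp: j_def L_def)
      have "fps_nth (fps_of_poly (E g) * R g) n = (\<Sum>i<L. e g i * of_int (\<phi> (g, i) (monom 1 j)))" for g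
      proof -
        have "fps_nth (fps_of_poly (E g) * R g) n = (\<Sum>m=0..n. e g (L - 1 - m) * fps_nth (R g) (n - m))"
          unfolding fps_mult_nth using n by (intro sum.cong) (auto simp: E)
        also have "\<dots> = (\<Sum>i=j..L-1. e g i * fps_nth (R g) (i - j))"
          by (rule sum.reindex_bij_witness[of _ "\<lambda>i. L - 1 - i" "\<lambda>m. L - 1 - m"])
             (use n j in \<open>auto intro!: arg_cong[of _ _ "fps_nth (R g)"]\<close>)
        also have "\<dots> = (\<Sum>i<L. e g i * of_int (\<phi> (g, i) (monom 1 j)))"
          by (rule sum.mono_neutral_cong_left)
             (use j in \<open>auto simp: \<phi>_def fps_of_poly_monom_mult_nth R_def\<close>)
        finally show ?thesis .
      qed
      then show ?thesis using rel[OF j(1)] by (simp add: S_def fps_sum_nth)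
    qed
    \<comment> \<open>The upper coefficients of \<open>E g\<close> form the geometric progression
      \<open>\<mu> g * y ^ i\<close>. Multiplication by x - y cancels them, except for
      \<open>\<mu> g\<close> at index \<open>L\<close>, which the subtracted term removes; only
      degrees below \<open>\<sigma>\<close> remain.\<close>
    define l where "l = (\<lambda>g. (fps_X - fps_const y) * fps_of_poly (E g) - fps_const (\<mu> g) * fps_X ^ L)"
    have l0: "fps_nth (l g) n = 0" if "n \<ge> \<sigma>" for g n
    proof -
      have n0: "n \<noteq> 0" using that \<sigma> by simp
      consider "n > L" "\<not> n - 1 \<le> L - 1" "\<not> n \<le> L - 1" | "n = L" | "n < L"
        using n0 L(1) by linarith
      then show ?thesis
      proof cases
        case 3
        then have "y ^ (L - n) = y * y ^ (L - Suc n)" "L - n \<le> D" "L - Suc n \<le> D"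
          "n \<le> L - 1" "n - 1 \<le> L - 1"
          using that n0 \<sigma> by (auto simp: L_def simp flip: power_Suc Suc_diff_Suc)
        then show ?thesis using 3 n0
          by (simp add: l_def fps_X_minus_const_mult_nth E e_def)
      qed (use n0 in \<open>auto simp: l_def fps_X_minus_const_mult_nth E e_def\<close>)
    qed
    define p where "p = (\<Sum>g\<in>I. l g * R g)"
    have p_eq: "p = (fps_X - fps_const y) * S - fps_X ^ L * (\<Sum>g\<in>I. fps_const (\<mu> g) * R g)"
      unfolding p_def l_def S_def sum_distrib_left sum_subtractf[symmetric]
      by (intro sum.cong refl) (simp add: algebra_simps)
    have p_low: "fps_nth p n = (if n = 0 then 0 else fps_nth S (n - 1)) - y * fps_nth S n" if "n < L" for n
      using that by (simp add: p_eq fps_X_minus_const_mult_nth fps_X_power_mult_nth)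
    have p_row: "fps_nth p (i + \<sigma>) = (\<Sum>a\<in>I \<times> {..<\<sigma>}. t i a * (case a of (g, j) \<Rightarrow> fps_nth (l g) j))" for i
    proof -
      have "fps_nth (l g * R g) (i + \<sigma>) = (\<Sum>j<\<sigma>. t i (g, j) * fps_nth (l g) j)" for g
        unfolding fps_mult_nth
        by (rule sum.mono_neutral_cong_right) (auto simp: l0 t_def)
      then show ?thesis by (simp add: p_def fps_sum_nth sum.cartesian_product split_beta)
    qed
    \<comment> \<open>Below index \<open>L\<close> only (x - y) S contributes to \<open>p\<close>.
      The zeros of \<open>S\<close> start at \<open>\<sigma> - 1\<close>, one index earlier than
      needed for \<open>p\<close>, because multiplication by x shifts.\<close>
    have "\<forall>i<D. fps_nth p (i + \<sigma>) = 0"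
      using p_low S0 \<sigma> by (auto simp: L_def)
    then have "\<forall>i. fps_nth p (i + \<sigma>) = 0"
      unfolding p_row by (rule D)
    then have p0: "fps_nth p n = 0" if "n \<ge> \<sigma>" for n
      using that by (metis le_add_diff_inverse2)
    have "eval_fps p y = (\<Sum>n<\<sigma>. fps_nth p n * y ^ n)"
      unfolding eval_fps_def by (rule suminf_finite) (auto simp: p0)
    also have "\<dots> = (\<Sum>n<\<sigma>. (if n = 0 then 0 else fps_nth S (n - 1) * y ^ n) - fps_nth S n * y ^ Suc n)"
      using L by (intro sum.cong) (auto simp: p_low algebra_simps)
    also have "\<dots> = - (fps_nth S (\<sigma> - 1) * y ^ \<sigma>)"
    proof -
      have "(\<Sum>n<Suc m. (if n = 0 then 0 else fps_nth S (n - 1) * y ^ n) - fps_nth S n * y ^ Suc n) =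
          - (fps_nth S m * y ^ Suc m)" for m
        by (induction m) simp_all
      from this[of "\<sigma> - 1"] show ?thesis using \<sigma> by simp
    qed
    also have "\<dots> = 0" using S0[of "\<sigma> - 1"] L \<sigma> by simp
    finally have evp: "eval_fps p y = 0" .
    have ny: "ereal (norm y) = ereal y" using y by simp
    have radS: "ereal y < fps_conv_radius S"
      unfolding S_def by (intro less_fps_conv_radius_sum less_fps_conv_radius_mult) (auto simp: rad)
    have radG: "ereal y < fps_conv_radius (fps_const (\<mu> g) * R g)" if "g \<in> I" for g
      using that by (intro less_fps_conv_radius_mult) (auto simp: rad)
    have radX: "ereal y < fps_conv_radius (fps_X - fps_const y)"
      by (intro less_fps_conv_radius_diff) auto
    have radGs: "ereal y < fps_conv_radius (\<Sum>g\<in>I. fps_const (\<mu> g) * R g)"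
      by (intro less_fps_conv_radius_sum radG) auto
    \<comment> \<open>The same value is computed a second time: at \<open>y\<close> the factor x - y
      disappears and \<open>- y ^ L\<close> times the exact form is left.\<close>
    have "eval_fps p y = (eval_fps fps_X y - y) * eval_fps S y
        - y ^ L * (\<Sum>g\<in>I. \<mu> g * eval_fps (R g) y)"
      unfolding p_eq
      by (subst eval_fps_diff eval_fps_mult; (simp only: ny)?;
          (intro less_fps_conv_radius_mult radX radS radGs; simp)?)+
         (auto simp: eval_fps_sum eval_fps_mult rad radG radGs y less_imp_le)
    with evp y show ?thesis by simp
  qed
  show ?thesis
    by (rule exI[of _ D], rule exI[of _ B])
      (use B(1,2) zero in \<open>auto simp: R_def P_def \<phi>_def L_def\<close>)
qed

section \<open>Substitution of powers of x, and remainders after a gap\<close>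

lemma fps_compose_X_power_nth:
  fixes F :: "'a::comm_ring_1 fps"
  assumes "m > 0"
  shows "fps_nth (fps_compose F (fps_X ^ m)) n = (if m dvd n then fps_nth F (n div m) else 0)"
proof -
  have "fps_nth (fps_compose F (fps_X ^ m)) n = (\<Sum>i=0..n. fps_nth F i * (if n = m * i then 1 else 0))"
    by (simp add: fps_compose_nth flip: power_mult)
  also have "\<dots> = (\<Sum>i\<in>{0..n}. if i = n div m \<and> m dvd n then fps_nth F i else 0)"
    using assms by (intro sum.cong) auto
  also have "\<dots> = (if m dvd n then fps_nth F (n div m) else 0)"
    by simp
  finally show ?thesis .
qed

lemma less_fps_conv_radius_le:
  assumes "0 \<le> x" "x \<le> y" "ereal y < R"
  shows "ereal (norm (x::real)) < R"
  using assms by (metis abs_of_nonneg ereal_less_eq(3) le_less_trans real_norm_def)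

text \<open>Summability at a single point bounds the radius only weakly, so a point \<open>u\<close>
  strictly beyond \<open>y\<close> is used; \<open>u < 1\<close> ensures that \<open>u ^ m\<close>
  does not leave the disc of \<open>F\<close>.\<close>

lemma fps_compose_X_power_eval:
  fixes F :: "real fps"
  assumes m: "m > 0" and y: "0 < y" "y < 1" "ereal y < fps_conv_radius F"
  shows "ereal y < fps_conv_radius (fps_compose F (fps_X ^ m))"
    and "eval_fps (fps_compose F (fps_X ^ m)) y = eval_fps F (y ^ m)"
proof -
  let ?H = "fps_compose F (fps_X ^ m)"
  have sm: "strict_mono ((*) m)" using m by (auto simp: strict_mono_def)
  have out: "fps_nth ?H n * x ^ n = 0" if "n \<notin> range ((*) m)" for n and x :: real
    using that m by (auto simp: fps_compose_X_power_nth dvd_def)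
  have "ereal y < min 1 (fps_conv_radius F)" using y by simp
  then obtain y' :: ereal where y': "ereal y < y'" "y' < min 1 (fps_conv_radius F)"
    using dense by blast
  then obtain u where u: "y' = ereal u" by (cases y') auto
  have u': "y < u" "u < 1" "ereal u < fps_conv_radius F" using y' unfolding u by auto
  have "u ^ m \<le> u ^ 1" using u' y m by (intro power_decreasing) auto
  then have "ereal (norm (u ^ m)) < fps_conv_radius F"
    using u' y by (intro less_fps_conv_radius_le[of _ u]) auto
  then have "summable (\<lambda>n. fps_nth F n * (u ^ m) ^ n)" by (rule summable_fps)
  then have "summable (\<lambda>n. fps_nth ?H (m * n) * u ^ (m * n))"
    using m by (simp add: fps_compose_X_power_nth power_mult)
  then have "summable (\<lambda>n. fps_nth ?H n * u ^ n)"
    using summable_mono_reindex[OF sm, of "\<lambda>n. fps_nth ?H n * u ^ n"] out by simp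
  then have "ereal (norm u) \<le> fps_conv_radius ?H"
    unfolding fps_conv_radius_def by (intro conv_radius_geI) auto
  then show "ereal y < fps_conv_radius ?H"
    using u' y by (metis abs_of_pos ereal_less_eq(3) less_ereal.simps(1) less_le_trans order.strict_trans real_norm_def)
  have "eval_fps F (y ^ m) = (\<Sum>n. fps_nth ?H (m * n) * y ^ (m * n))"
    using m by (simp add: eval_fps_def fps_compose_X_power_nth power_mult)
  also have "\<dots> = eval_fps ?H y"
    unfolding eval_fps_def
    using suminf_mono_reindex[OF sm, of "\<lambda>n. fps_nth ?H n * y ^ n"] out by simp
  finally show "eval_fps ?H y = eval_fps F (y ^ m)" ..
qed

lemma real_fps_compose_X_power:
  "m > 0 \<Longrightarrow> real_fps (fps_compose F (fps_X ^ m)) = fps_compose (real_fps F) (fps_X ^ m)"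
  by (rule fps_ext) (simp add: fps_compose_X_power_nth)

text \<open>The constant is the sum of the absolute values of the tail at \<open>r\<close>, divided
  by \<open>r ^ L\<close>. It serves all \<open>y\<close> up to \<open>r\<close>; the gap lowers the
  truncation from \<open>L\<close> to \<open>D\<close> at no cost.\<close>

lemma eval_fps_gap_remainder:
  fixes H :: "real fps"
  assumes r: "0 < r" "ereal r < fps_conv_radius H"
  shows "\<exists>K\<ge>0. \<forall>D y. (\<forall>i. D < i \<and> i < L \<longrightarrow> fps_nth H i = 0) \<longrightarrow> D < L \<longrightarrow> 0 \<le> y \<longrightarrow> y \<le> r \<longrightarrow>
     \<bar>eval_fps H y - (\<Sum>i\<le>D. y ^ i * fps_nth H i)\<bar> \<le> K * y ^ L"
proof -
  have "summable (\<lambda>n. norm (fps_nth (fps_shift L H) n * r ^ n))"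
    by (rule norm_summable_fps) (use r in simp)
  then have sum: "summable (\<lambda>n. \<bar>fps_nth H (n + L)\<bar> * r ^ n)"
    using r by (simp add: abs_mult)
  define K where "K = (\<Sum>n. \<bar>fps_nth H (n + L)\<bar> * r ^ n)"
  show ?thesis
  proof (intro exI[of _ K] conjI allI impI)
    show "K \<ge> 0" unfolding K_def using sum r by (intro suminf_nonneg) auto
    fix D y
    assume gap: "\<forall>i. D < i \<and> i < L \<longrightarrow> fps_nth H i = 0" and D: "D < L" and y: "0 \<le> y" "y \<le> r"
    have le: "norm (fps_nth H (n + L) * y ^ n) \<le> \<bar>fps_nth H (n + L)\<bar> * r ^ n" for n
      using y by (simp add: abs_mult mult_left_mono power_mono)
    have sy: "summable (\<lambda>n. norm (fps_nth H (n + L) * y ^ n))"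
      by (rule summable_comparison_test'[OF sum, of 0]) (use le in auto)
    have "summable (\<lambda>n. fps_nth H n * y ^ n)"
      by (rule summable_fps) (rule less_fps_conv_radius_le[OF y r(2)])
    then have "eval_fps H y = (\<Sum>n. fps_nth H (n + L) * y ^ (n + L)) + (\<Sum>i<L. fps_nth H i * y ^ i)"
      unfolding eval_fps_def by (rule suminf_split_initial_segment)
    also have "(\<Sum>i<L. fps_nth H i * y ^ i) = (\<Sum>i\<le>D. y ^ i * fps_nth H i)"
      using D gap by (intro sum.mono_neutral_cong_right) (auto simp: not_le mult.commute)
    also have "(\<Sum>n. fps_nth H (n + L) * y ^ (n + L)) = (\<Sum>n. fps_nth H (n + L) * y ^ n) * y ^ L"
      using suminf_mult2[OF summable_norm_cancel[OF sy], of "y ^ L"] by (simp add: power_add mult.assoc)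
    finally have "\<bar>eval_fps H y - (\<Sum>i\<le>D. y ^ i * fps_nth H i)\<bar> = \<bar>\<Sum>n. fps_nth H (n + L) * y ^ n\<bar> * y ^ L"
      using y by (simp add: abs_mult)
    also have "\<bar>\<Sum>n. fps_nth H (n + L) * y ^ n\<bar> \<le> K"
      unfolding K_def using summable_norm[OF sy] suminf_le[OF le sy sum] by simp
    finally show "\<bar>eval_fps H y - (\<Sum>i\<le>D. y ^ i * fps_nth H i)\<bar> \<le> K * y ^ L"
      using y by (simp add: mult_right_mono)
  qed
qed

section \<open>Clearing denominators in values of integer polynomials at 1/z\<close>

text \<open>For \<open>degree P \<le> e\<close> this is the integer z^e P(1/z). The exponent is a
  parameter so that all entries of a system can be scaled alike.\<close>

definition homogenise :: "nat \<Rightarrow> int poly \<Rightarrow> nat \<Rightarrow> int" where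
  "homogenise e P z = (\<Sum>i\<le>e. coeff P i * int z ^ (e - i))"

definition coeff_length :: "int poly \<Rightarrow> nat" where
  "coeff_length P = (\<Sum>i\<le>degree P. nat \<bar>coeff P i\<bar>)"

lemma homogenise_eq:
  assumes "degree P \<le> e" "z > 0"
  shows "of_int (homogenise e P z) = real z ^ e * poly (map_poly of_int P) (1 / real z)"
proof -
  have "poly (map_poly of_int P) (1 / real z) = (\<Sum>i\<le>e. of_int (coeff P i) * (1 / real z) ^ i)"
    unfolding poly_altdef using assms
    by (intro sum.mono_neutral_cong_left) (auto simp: coeff_map_poly coeff_eq_0 degree_map_poly)
  moreover have "real z ^ (e - i) = real z ^ e * (1 / real z) ^ i" if "i \<le> e" for i
    using that assms(2) by (simp add: power_diff field_simps)
  ultimately show ?thesis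
    by (simp add: homogenise_def sum_distrib_left mult_ac)
qed

lemma abs_poly_le_coeff_length:
  assumes "0 \<le> y" "y \<le> 1"
  shows "\<bar>poly (map_poly of_int P) y\<bar> \<le> real (coeff_length P)"
proof -
  have "\<bar>poly (map_poly of_int P) y\<bar> \<le> (\<Sum>i\<le>degree P. \<bar>of_int (coeff P i) * y ^ i\<bar>)"
    unfolding poly_altdef by (simp add: coeff_map_poly degree_map_poly)
  also have "\<dots> \<le> (\<Sum>i\<le>degree P. \<bar>of_int (coeff P i)\<bar>)"
    using assms by (intro sum_mono) (auto simp: abs_mult power_le_one mult_left_le)
  finally show ?thesis by (simp add: coeff_length_def)
qed

lemma abs_homogenise_le:
  assumes "degree P \<le> e" "z > 0"
  shows "\<bar>real_of_int (homogenise e P z)\<bar> \<le> real (coeff_length P) * real z ^ e"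
  unfolding homogenise_eq[OF assms] abs_mult
  using abs_poly_le_coeff_length[of "1 / real z" P] assms(2)
  by (simp add: mult.commute mult_left_mono)

lemma finite_bounded_nat:
  fixes f :: "'a \<Rightarrow> nat"
  assumes "finite A"
  obtains N where "\<And>x. x \<in> A \<Longrightarrow> f x \<le> N"
  using finite_nat_set_iff_bounded_le[of "f ` A"] assms by auto

section \<open>Iterating a Mahler system and bounding linear forms in its values\<close>

text \<open>One step from z_n costs a factor of at most z_n^E. Since z_(n+1) = z_n^k and k >= 2, the
  bound z_n^E times this cost is at most z_(n+1)^E, so the same \<open>E\<close> survives the
  induction.\<close>

lemma mahler_system_iterate:
  fixes G :: "'i \<Rightarrow> int fps" and \<delta> :: "int poly" and M :: "'i \<Rightarrow> 'i \<Rightarrow> int poly"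
  assumes I: "finite I" and k: "k \<ge> 2" and b: "b \<ge> 2"
    and sys: "\<forall>g\<in>I. fps_of_poly \<delta> * G g =
        (\<Sum>h\<in>I. fps_of_poly (M g h) * fps_compose (G h) (fps_X ^ k))"
    and nz: "\<forall>n. poly (map_poly of_int \<delta>) (1 / real (b ^ k ^ n)) \<noteq> 0"
    and rad: "\<forall>g\<in>I. ereal (1 / real b) < fps_conv_radius (real_fps (G g))"
  shows "\<exists>E. \<forall>(w::'i \<Rightarrow> int) (X::real) n. (\<forall>g\<in>I. \<bar>w g\<bar> \<le> X) \<longrightarrow>
     (\<exists>(\<Delta>::int) \<mu>. \<Delta> \<noteq> 0 \<and> \<bar>\<Delta>\<bar> \<le> real (b ^ k ^ n) ^ E \<and>
       (\<forall>g\<in>I. \<bar>of_int (\<mu> g)\<bar> \<le> X * real (b ^ k ^ n) ^ E) \<and>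
       \<Delta> * (\<Sum>g\<in>I. w g * eval_fps (real_fps (G g)) (1 / real b)) =
         (\<Sum>g\<in>I. \<mu> g * eval_fps (real_fps (G g)) (1 / real (b ^ k ^ n))))"
proof -
  note sys = sys[rule_format] and rad = rad[rule_format] and nz = nz[rule_format]
  define z where "z = (\<lambda>n. b ^ k ^ n)"
  define V where "V = (\<lambda>n g. eval_fps (real_fps (G g)) (1 / real (z n)))"
  have z2: "z n \<ge> 2" for n
  proof -
    have "b ^ 1 \<le> b ^ k ^ n" using k b by (intro power_increasing) auto
    then show ?thesis using b by (simp add: z_def)
  qed
  have zb: "b \<le> z n" for n
  proof -
    have "b ^ 1 \<le> b ^ k ^ n" using k b by (intro power_increasing) auto
    then show ?thesis by (simp add: z_def)
  qed
  have zS: "z (Suc n) = z n ^ k" for n by (simp add: z_def power_mult[symmetric] mult.commute)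
  have rad': "ereal (1 / real (z n)) < fps_conv_radius (real_fps (G g))" if "g \<in> I" for g n
    using less_fps_conv_radius_le[OF _ _ rad[OF that], of "1 / real (z n)"] zb[of n] b
    by (simp add: frac_le)
  have num: "poly (map_poly of_int \<delta>) (1 / real (z n)) * V n g =
      (\<Sum>h\<in>I. poly (map_poly of_int (M g h)) (1 / real (z n)) * V (Suc n) h)" if g: "g \<in> I" for n g
  proof -
    define y where "y = 1 / real (z n)"
    have y: "0 < y" "y < 1" "ereal (norm y) = ereal y" using z2[of n] by (auto simp: y_def)
    have ry: "ereal y < fps_conv_radius (real_fps (G h))" if "h \<in> I" for h
      using rad'[OF that] by (simp add: y_def)
    have yk: "y ^ k = 1 / real (z (Suc n))" by (simp add: y_def zS power_one_over)
    note cmp = fps_compose_X_power_eval[OF _ y(1,2) ry, of k]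
    have k0: "k > 0" using k by simp
    have "real_fps (fps_of_poly \<delta> * G g) =
       real_fps (\<Sum>h\<in>I. fps_of_poly (M g h) * fps_compose (G h) (fps_X ^ k))"
      using sys[OF g] by simp
    then have eq: "fps_of_poly (map_poly of_int \<delta>) * real_fps (G g) =
       (\<Sum>h\<in>I. fps_of_poly (map_poly of_int (M g h)) * fps_compose (real_fps (G h)) (fps_X ^ k))"
      by (simp add: real_fps_mult real_fps_sum real_fps_of_poly real_fps_compose_X_power k0)
    have "poly (map_poly of_int \<delta>) y * V n g = eval_fps (fps_of_poly (map_poly of_int \<delta>) * real_fps (G g)) y"
      using ry[OF g] y by (subst eval_fps_mult) (auto simp: V_def y_def)
    also have "\<dots> = (\<Sum>h\<in>I. eval_fps (fps_of_poly (map_poly of_int (M g h)) * fps_compose (real_fps (G h)) (fps_X ^ k)) y)"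
      unfolding eq using cmp(1) k0 y by (intro eval_fps_sum less_fps_conv_radius_mult) auto
    also have "\<dots> = (\<Sum>h\<in>I. poly (map_poly of_int (M g h)) y * V (Suc n) h)"
    proof (rule sum.cong[OF refl])
      fix h assume h: "h \<in> I"
      show "eval_fps (fps_of_poly (map_poly of_int (M g h)) * fps_compose (real_fps (G h)) (fps_X ^ k)) y =
          poly (map_poly of_int (M g h)) y * V (Suc n) h"
        using cmp[OF k0 h] y by (subst eval_fps_mult) (auto simp: V_def yk)
    qed
    finally show ?thesis unfolding y_def .
  qed
  define Ps where "Ps = insert \<delta> ((\<lambda>(g, h). M g h) ` (I \<times> I))"
  have fin: "finite Ps" using I by (simp add: Ps_def)
  obtain e where e: "\<And>P. P \<in> Ps \<Longrightarrow> degree P \<le> e" using finite_bounded_nat[OF fin] by blast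
  obtain K where K: "\<And>P. P \<in> Ps \<Longrightarrow> coeff_length P \<le> K" using finite_bounded_nat[OF fin] by blast
  \<comment> \<open>The constant factor of a step is absorbed into a power of z_n by c <= 2^c <=
    z_n^c. The summand 1 lets the same constant cover \<open>\<Delta>\<close>, whose step involves
    no sum over \<open>I\<close>.\<close>
  define c where "c = (card I + 1) * K"
  define E where "E = c + e"
  have MP: "\<delta> \<in> Ps" "g \<in> I \<Longrightarrow> h \<in> I \<Longrightarrow> M g h \<in> Ps" for g h
    by (auto simp: Ps_def)
  have hb: "\<bar>real_of_int (homogenise e P (z n))\<bar> \<le> K * real (z n) ^ e" if "P \<in> Ps" for P n
  proof -
    have "\<bar>real_of_int (homogenise e P (z n))\<bar> \<le> coeff_length P * real (z n) ^ e"
      using e[OF that] z2[of n] by (intro abs_homogenise_le) auto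
    also have "\<dots> \<le> K * real (z n) ^ e"
      using K[OF that] by (intro mult_right_mono) auto
    finally show ?thesis .
  qed
  have grow: "(real (card I + 1) * K * real (z n) ^ e) * real (z n) ^ E \<le> real (z (Suc n)) ^ E" for n
  proof -
    have zn: "real (z n) \<ge> 2" using z2[of n] by simp
    have "real c \<le> 2 ^ c" by (metis less_imp_le of_nat_less_two_power)
    also have "\<dots> \<le> real (z n) ^ c" using zn by (intro power_mono) auto
    finally have "real (card I + 1) * K \<le> real (z n) ^ c" by (simp only: c_def of_nat_mult)
    then have "(real (card I + 1) * K * real (z n) ^ e) * real (z n) ^ E \<le>
       (real (z n) ^ c * real (z n) ^ e) * real (z n) ^ E"
      by (intro mult_right_mono) auto
    also have "\<dots> = real (z n) ^ (2 * E)"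
      by (simp add: E_def mult_2 add_ac flip: power_add)
    also have "\<dots> \<le> real (z n) ^ (k * E)"
      using zn k by (intro power_increasing mult_right_mono) auto
    also have "\<dots> = real (z (Suc n)) ^ E" by (simp add: zS power_mult)
    finally show ?thesis .
  qed
  have "\<exists>(\<Delta>::int) \<mu>. \<Delta> \<noteq> 0 \<and> \<bar>\<Delta>\<bar> \<le> real (z n) ^ E \<and>
       (\<forall>g\<in>I. \<bar>of_int (\<mu> g)\<bar> \<le> X * real (z n) ^ E) \<and>
       \<Delta> * (\<Sum>g\<in>I. w g * V 0 g) = (\<Sum>g\<in>I. \<mu> g * V n g)"
    if lam: "\<And>g. g \<in> I \<Longrightarrow> \<bar>w g\<bar> \<le> X" for w :: "'i \<Rightarrow> int" and X :: real and n
  proof (induction n)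
    case 0
    have "\<bar>of_int (w g)\<bar> \<le> X * real (z 0) ^ E" if "g \<in> I" for g
    proof -
      have "0 \<le> X" using lam[OF that] by linarith
      then have "X * 1 \<le> X * real (z 0) ^ E"
        using z2[of 0] by (intro mult_left_mono) auto
      then show ?thesis using lam[OF that] by simp
    qed
    then show ?case
      using z2[of 0] by (intro exI[of _ 1] exI[of _ w]) auto
  next
    case (Suc n)
    then obtain \<Delta> :: int and \<mu> :: "'i \<Rightarrow> int" where IH: "\<Delta> \<noteq> 0" "\<bar>\<Delta>\<bar> \<le> real (z n) ^ E"
      "\<And>g. g \<in> I \<Longrightarrow> \<bar>of_int (\<mu> g)\<bar> \<le> X * real (z n) ^ E"
      "\<Delta> * (\<Sum>g\<in>I. w g * V 0 g) = (\<Sum>g\<in>I. \<mu> g * V n g)" by auto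
    have z0: "z n > 0" using z2[of n] by simp
    define \<Delta>' where "\<Delta>' = \<Delta> * homogenise e \<delta> (z n)"
    define \<mu>' where "\<mu>' = (\<lambda>h. \<Sum>g\<in>I. \<mu> g * homogenise e (M g h) (z n))"
    have heq: "of_int (homogenise e P (z n)) = real (z n) ^ e * poly (map_poly of_int P) (1 / real (z n))"
      if "P \<in> Ps" for P
      using e[OF that] z0 by (rule homogenise_eq)
    have "real_of_int (homogenise e \<delta> (z n)) \<noteq> 0"
      unfolding heq[OF MP(1)] using nz[of n] b by (simp add: z_def)
    then have "\<Delta>' \<noteq> 0" using IH(1) by (simp add: \<Delta>'_def)
    moreover have "\<bar>\<Delta>'\<bar> \<le> real (z (Suc n)) ^ E"
    proof -
      have "\<bar>real_of_int \<Delta>'\<bar> \<le> real (z n) ^ E * (K * real (z n) ^ e)"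
        using IH(2) hb[OF MP(1), of n] by (simp add: \<Delta>'_def abs_mult mult_mono)
      also have "\<dots> \<le> (real (card I + 1) * K * real (z n) ^ e) * real (z n) ^ E"
        by (simp add: algebra_simps)
      also note grow
      finally show ?thesis by simp
    qed
    moreover have "\<forall>h\<in>I. \<bar>of_int (\<mu>' h)\<bar> \<le> X * real (z (Suc n)) ^ E"
    proof
      fix h assume h: "h \<in> I"
      have X: "0 \<le> X" using lam[OF h] by linarith
      have "\<bar>real_of_int (\<mu>' h)\<bar> \<le> (\<Sum>g\<in>I. \<bar>real_of_int (\<mu> g) * real_of_int (homogenise e (M g h) (z n))\<bar>)"
        unfolding \<mu>'_def by (simp only: of_int_sum of_int_mult sum_abs)
      also have "\<dots> \<le> (\<Sum>g\<in>I. (X * real (z n) ^ E) * (K * real (z n) ^ e))"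
        unfolding abs_mult using IH(3) hb[OF MP(2)[OF _ h], of _ n] X
        by (intro sum_mono mult_mono) auto
      also have "\<dots> \<le> X * ((real (card I + 1) * K * real (z n) ^ e) * real (z n) ^ E)"
        using X by (simp add: algebra_simps)
      also have "\<dots> \<le> X * real (z (Suc n)) ^ E"
        using grow X by (rule mult_left_mono)
      finally show "\<bar>of_int (\<mu>' h)\<bar> \<le> X * real (z (Suc n)) ^ E" .
    qed
    moreover have "\<Delta>' * (\<Sum>g\<in>I. w g * V 0 g) = (\<Sum>h\<in>I. \<mu>' h * V (Suc n) h)"
    proof -
      have "\<Delta>' * (\<Sum>g\<in>I. w g * V 0 g) =
          homogenise e \<delta> (z n) * (\<Delta> * (\<Sum>g\<in>I. w g * V 0 g))"
        by (simp add: \<Delta>'_def mult_ac)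
      also have "\<dots> = (\<Sum>g\<in>I. \<mu> g * (homogenise e \<delta> (z n) * V n g))"
        by (subst IH(4)) (simp add: sum_distrib_left mult_ac)
      also have "\<dots> = (\<Sum>g\<in>I. \<mu> g * (\<Sum>h\<in>I. homogenise e (M g h) (z n) * V (Suc n) h))"
      proof (rule sum.cong[OF refl])
        fix g assume g: "g \<in> I"
        have "homogenise e \<delta> (z n) * V n g = real (z n) ^ e *
            (\<Sum>h\<in>I. poly (map_poly of_int (M g h)) (1 / real (z n)) * V (Suc n) h)"
          unfolding heq[OF MP(1)] num[OF g, symmetric] by simp
        also have "\<dots> = (\<Sum>h\<in>I. homogenise e (M g h) (z n) * V (Suc n) h)"
          unfolding sum_distrib_left by (intro sum.cong refl) (simp add: heq MP(2) g)
        finally show "\<mu> g * (homogenise e \<delta> (z n) * V n g) =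
           \<mu> g * (\<Sum>h\<in>I. homogenise e (M g h) (z n) * V (Suc n) h)" by simp
      qed
      also have "\<dots> = (\<Sum>g\<in>I. \<Sum>h\<in>I. \<mu> g * homogenise e (M g h) (z n) * V (Suc n) h)"
        by (simp add: sum_distrib_left mult.assoc)
      also have "\<dots> = (\<Sum>h\<in>I. \<mu>' h * V (Suc n) h)"
        by (subst sum.swap) (simp add: \<mu>'_def sum_distrib_right)
      finally show ?thesis .
    qed
    ultimately show ?case by blast
  qed
  then show ?thesis by (intro exI[of _ E]) (simp add: z_def V_def)
qed

text \<open>Multiplied by z^D, a nonvanishing truncated form is a nonzero integer, so the form
  itself is at least y^D in absolute value. Making the remainder at most half of this bounds the
  exact form from below.\<close>

lemma mahler_system_linear_forms:
  fixes G :: "'i \<Rightarrow> int fps" and \<delta> :: "int poly" and M :: "'i \<Rightarrow> 'i \<Rightarrow> int poly"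
  assumes I: "finite I" and k: "k \<ge> 2" and b: "b \<ge> 2"
    and sys: "\<forall>g\<in>I. fps_of_poly \<delta> * G g =
        (\<Sum>h\<in>I. fps_of_poly (M g h) * fps_compose (G h) (fps_X ^ k))"
    and nz: "\<forall>n. poly (map_poly of_int \<delta>) (1 / real (b ^ k ^ n)) \<noteq> 0"
    and rad: "\<forall>g\<in>I. ereal (1 / real b) < fps_conv_radius (real_fps (G g))"
  shows "\<exists>C>0. \<exists>\<kappa>::nat. \<forall>(w::'i \<Rightarrow> int) (X::real) (\<Lambda>::real). X \<ge> 1 \<longrightarrow> (\<forall>g\<in>I. \<bar>of_int (w g)\<bar> \<le> X) \<longrightarrow>
       \<Lambda> = (\<Sum>g\<in>I. w g * eval_fps (real_fps (G g)) (1 / real b)) \<longrightarrow> \<Lambda> \<noteq> 0 \<longrightarrow>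
       1 \<le> \<bar>\<Lambda>\<bar> * (C * X ^ \<kappa>)"
proof -
  from mahler_system_iterate[OF I k b sys nz rad] obtain E where
    E: "\<forall>(w::'i \<Rightarrow> int) (X::real) n. (\<forall>g\<in>I. \<bar>w g\<bar> \<le> X) \<longrightarrow>
     (\<exists>(\<Delta>::int) \<mu>. \<Delta> \<noteq> 0 \<and> \<bar>\<Delta>\<bar> \<le> real (b ^ k ^ n) ^ E \<and>
       (\<forall>g\<in>I. \<bar>of_int (\<mu> g)\<bar> \<le> X * real (b ^ k ^ n) ^ E) \<and>
       \<Delta> * (\<Sum>g\<in>I. w g * eval_fps (real_fps (G g)) (1 / real b)) =
         (\<Sum>g\<in>I. \<mu> g * eval_fps (real_fps (G g)) (1 / real (b ^ k ^ n))))"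
    by (elim exE) (rule that)
  note rad = rad[rule_format]
  \<comment> \<open>\<open>E\<close> powers of y cancel the growth z^E of the coefficients; the
    additional one makes the remainder small compared with y^D.\<close>
  define \<sigma> where "\<sigma> = Suc E"
  have "\<sigma> \<ge> 1" by (simp add: \<sigma>_def)
  from gap_polynomials_detect_zero[OF I this, of G] obtain D B where B: "finite B"
     "\<forall>Q\<in>B. \<forall>g\<in>I. \<forall>i. D < i \<and> i < D + \<sigma> \<longrightarrow> fps_nth (fps_of_poly Q * G g) i = 0"
     and detect: "\<forall>y \<mu>. 0 < y \<longrightarrow> (\<forall>g\<in>I. ereal y < fps_conv_radius (real_fps (G g))) \<longrightarrow>
        (\<forall>Q\<in>B. (\<Sum>g\<in>I. \<mu> g * (\<Sum>i\<le>D. y ^ i * of_int (fps_nth (fps_of_poly Q * G g) i))) = 0) \<longrightarrow>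
        (\<Sum>g\<in>I. \<mu> g * eval_fps (real_fps (G g)) y) = 0"
    by (elim exE conjE) (rule that)
  define H where "H = (\<lambda>Q g. real_fps (fps_of_poly Q * G g))"
  have H: "H Q g = fps_of_poly (map_poly of_int Q) * real_fps (G g)" for Q g
    by (simp add: H_def real_fps_mult real_fps_of_poly)
  have radH: "ereal (1 / real b) < fps_conv_radius (H Q g)" if "g \<in> I" for Q g
    unfolding H using rad[OF that] by (intro less_fps_conv_radius_mult) auto
  have ex: "\<exists>K\<ge>0. \<forall>y. 0 \<le> y \<longrightarrow> y \<le> 1 / real b \<longrightarrow>
     \<bar>eval_fps (H Q g) y - (\<Sum>i\<le>D. y ^ i * fps_nth (H Q g) i)\<bar> \<le> K * y ^ (D + \<sigma>)"
    if gI: "g \<in> I" and QB: "Q \<in> B" for Q g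
  proof -
    obtain K where "K \<ge> 0" "\<forall>D' y. (\<forall>i. D' < i \<and> i < D + \<sigma> \<longrightarrow> fps_nth (H Q g) i = 0) \<longrightarrow>
       D' < D + \<sigma> \<longrightarrow> 0 \<le> y \<longrightarrow> y \<le> 1 / real b \<longrightarrow>
       \<bar>eval_fps (H Q g) y - (\<Sum>i\<le>D'. y ^ i * fps_nth (H Q g) i)\<bar> \<le> K * y ^ (D + \<sigma>)"
      using eval_fps_gap_remainder[OF _ radH[OF gI, of Q], of "D + \<sigma>"] b by auto
    moreover have "\<forall>i. D < i \<and> i < D + \<sigma> \<longrightarrow> fps_nth (H Q g) i = 0"
      using B(2) gI QB by (simp add: H_def)
    ultimately show ?thesis by (auto simp: \<sigma>_def)
  qed
  define K where "K = (\<lambda>Q g. SOME K. K \<ge> 0 \<and> (\<forall>y. 0 \<le> y \<longrightarrow> y \<le> 1 / real b \<longrightarrow>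
     \<bar>eval_fps (H Q g) y - (\<Sum>i\<le>D. y ^ i * fps_nth (H Q g) i)\<bar> \<le> K * y ^ (D + \<sigma>)))"
  have KK: "K Q g \<ge> 0 \<and> (\<forall>y. 0 \<le> y \<longrightarrow> y \<le> 1 / real b \<longrightarrow>
     \<bar>eval_fps (H Q g) y - (\<Sum>i\<le>D. y ^ i * fps_nth (H Q g) i)\<bar> \<le> K Q g * y ^ (D + \<sigma>))"
    if "g \<in> I" "Q \<in> B" for Q g
    using someI_ex[OF ex[OF that]] unfolding K_def .
  then have K0: "K Q g \<ge> 0" if "g \<in> I" "Q \<in> B" for Q g
    using that by simp
  have K: "\<bar>eval_fps (H Q g) y - (\<Sum>i\<le>D. y ^ i * fps_nth (H Q g) i)\<bar> \<le> K Q g * y ^ (D + \<sigma>)"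
    if "g \<in> I" "Q \<in> B" "0 \<le> y" "y \<le> 1 / real b" for Q g y
    using KK[OF that(1,2)] that(3,4) by simp
  \<comment> \<open>The multiplier \<open>Q\<close> is selected only after the form is known, so the
    remainder constants of all of \<open>B\<close> are summed.\<close>
  define T where "T = 1 + (\<Sum>Q\<in>B. \<Sum>g\<in>I. K Q g)"
  have T: "T \<ge> 1" unfolding T_def using K0 by (auto intro!: sum_nonneg)
  have TQ: "(\<Sum>g\<in>I. K Q g) \<le> T" if "Q \<in> B" for Q
  proof -
    have "(\<Sum>g\<in>I. K Q g) \<le> (\<Sum>Q\<in>B. \<Sum>g\<in>I. K Q g)"
      using that B(1) K0 by (intro member_le_sum sum_nonneg) auto
    then show ?thesis by (simp add: T_def)
  qed
  obtain N0 where N0: "\<And>Q. Q \<in> B \<Longrightarrow> coeff_length Q \<le> N0" using finite_bounded_nat[OF B(1)] by blast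
  define N where "N = real N0 + 1"
  have N: "N > 0" by (simp add: N_def)
  \<comment> \<open>Result of inserting the upper bound \<open>z \<le> real b * W ^ k\<close> into
    the final inequality
    \<open>1 \<le> \<bar>\<Lambda>\<bar> * (2 * N * z ^ (E + D))\<close>.\<close>
  define C where "C = 2 * N * (real b * (2 * T) ^ k) ^ (E + D)"
  have C: "C > 0" using N T b by (simp add: C_def)
  show ?thesis
  proof (rule exI[of _ C], intro conjI C, rule exI[of _ "k * (E + D)"], intro allI impI)
    fix w :: "'i \<Rightarrow> int" and X \<Lambda> :: real
    assume X: "X \<ge> 1" and lam: "\<forall>g\<in>I. \<bar>of_int (w g)\<bar> \<le> X"
      and \<Lambda>: "\<Lambda> = (\<Sum>g\<in>I. w g * eval_fps (real_fps (G g)) (1 / real b))" and nonzero: "\<Lambda> \<noteq> 0"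
    \<comment> \<open>The remainder is at most \<open>X * T * y * y ^ D\<close>, so
      \<open>z \<ge> W\<close> makes it at most half of \<open>y ^ D\<close>.\<close>
    define W where "W = 2 * T * X"
    have W: "W \<ge> 1" using mult_mono[OF T X] T by (simp add: W_def)
    have "\<exists>n. W \<le> real (b ^ k ^ n)"
    proof -
      obtain m where m: "W \<le> real m" using real_arch_simple by blast
      have "m \<le> 2 ^ m" by (simp add: less_imp_le)
      also have "2 ^ m \<le> k ^ m" using k by (intro power_mono) auto
      finally have "m \<le> k ^ m" by simp
      also have "\<dots> \<le> 2 ^ (k ^ m)" by (simp add: less_imp_le)
      also have "\<dots> \<le> b ^ (k ^ m)" using b by (intro power_mono) auto
      finally show ?thesis using m by (intro exI[of _ m]) (metis of_nat_le_iff order_trans)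
    qed
    define n where "n = (LEAST n. W \<le> real (b ^ k ^ n))"
    have n: "W \<le> real (b ^ k ^ n)"
      unfolding n_def by (rule LeastI_ex) fact
    define z where "z = real (b ^ k ^ n)"
    \<comment> \<open>By minimality the preceding orbit denominator is below \<open>W\<close>, and
      \<open>z\<close> is its k-th power. The factor \<open>b\<close> covers \<open>n = 0\<close>,
      where there is no predecessor.\<close>
    have z_up: "z \<le> real b * W ^ k"
    proof (cases n)
      case 0
      then show ?thesis using W b by (simp add: z_def)
    next
      case (Suc m)
      then have "\<not> W \<le> real (b ^ k ^ m)" using not_less_Least[of m] by (metis lessI n_def)
      then have "real (b ^ k ^ m) ^ k \<le> W ^ k" by (intro power_mono) auto
      moreover have "z = real (b ^ k ^ m) ^ k"
        by (simp add: z_def Suc mult.commute[of k] flip: power_mult)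
      ultimately have "z \<le> W ^ k" by simp
      also have "\<dots> \<le> real b * W ^ k" using W b by simp
      finally show ?thesis .
    qed
    have zb: "z \<ge> real b"
    proof -
      have "b ^ 1 \<le> b ^ k ^ n" using k b by (intro power_increasing) auto
      then have "real (b ^ 1) \<le> real (b ^ k ^ n)" by (rule of_nat_mono)
      then show ?thesis by (simp add: z_def)
    qed
    have z2: "z \<ge> 2" using zb b by simp
    define y where "y = 1 / z"
    have y: "0 < y" "y \<le> 1 / real b" "y \<le> 1" "ereal (norm y) = ereal y" using z2 zb b by (auto simp: y_def frac_le)
    have rady: "ereal y < fps_conv_radius (real_fps (G g))" if "g \<in> I" for g
      using less_fps_conv_radius_le[OF _ y(2) rad[OF that]] y by simp
    obtain \<Delta> :: int and \<mu> :: "'i \<Rightarrow> int" where D1: "\<Delta> \<noteq> 0" "\<bar>\<Delta>\<bar> \<le> z ^ E"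
      "\<forall>g\<in>I. \<bar>of_int (\<mu> g)\<bar> \<le> X * z ^ E"
      "\<Delta> * \<Lambda> = (\<Sum>g\<in>I. \<mu> g * eval_fps (real_fps (G g)) y)"
      using E[THEN spec, THEN spec, THEN spec, THEN mp, of w X n] lam unfolding \<Lambda> y_def z_def by auto
    \<comment> \<open>The detection property is used in contrapositive form: the exact form at
      \<open>y\<close> is nonzero, hence so is the truncated form of some \<open>Q\<close>.\<close>
    have "\<Delta> * \<Lambda> \<noteq> 0" using D1(1) nonzero by simp
    then obtain Q where Q: "Q \<in> B"
        "(\<Sum>g\<in>I. \<mu> g * (\<Sum>i\<le>D. y ^ i * of_int (fps_nth (fps_of_poly Q * G g) i))) \<noteq> 0" (is "?m \<noteq> 0")
      using detect[rule_format, of y \<mu>] y(1) rady unfolding D1(4) by blast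
    have abs_ge_1: "1 \<le> \<bar>r\<bar>" if "r = of_int j" "r \<noteq> 0" for r :: real and j :: int
      using that by (cases "j \<ge> 0") auto
    have "z ^ D * ?m = of_int (\<Sum>g\<in>I. \<mu> g * (\<Sum>i\<le>D. (int (b ^ k ^ n)) ^ (D - i) * fps_nth (fps_of_poly Q * G g) i))"
    proof -
      have "z ^ D * y ^ i = z ^ (D - i)" if "i \<le> D" for i
        using that z2 by (simp add: y_def power_diff power_one_over)
      then have "z ^ D * (\<Sum>i\<le>D. y ^ i * of_int (fps_nth (fps_of_poly Q * G g) i)) =
          (\<Sum>i\<le>D. z ^ (D - i) * of_int (fps_nth (fps_of_poly Q * G g) i))" for g
        unfolding sum_distrib_left by (intro sum.cong) (auto simp flip: mult.assoc)
      moreover have "z ^ D * ?m = (\<Sum>g\<in>I. \<mu> g * (z ^ D * (\<Sum>i\<le>D. y ^ i * of_int (fps_nth (fps_of_poly Q * G g) i))))"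
        by (simp only: sum_distrib_left[of "z ^ D"] mult.left_commute)
      ultimately show ?thesis by (simp add: z_def)
    qed
    moreover have "z ^ D * ?m \<noteq> 0" using Q(2) z2 by simp
    ultimately have int1: "1 \<le> \<bar>z ^ D * ?m\<bar>"
      by (rule abs_ge_1)
    have m: "?m = (\<Sum>g\<in>I. \<mu> g * (\<Sum>i\<le>D. y ^ i * fps_nth (H Q g) i))" by (simp add: H_def)
    have "poly (map_poly of_int Q) y * (\<Delta> * \<Lambda>) = (\<Sum>g\<in>I. \<mu> g * eval_fps (H Q g) y)"
    proof -
      have "eval_fps (H Q g) y = poly (map_poly of_int Q) y * eval_fps (real_fps (G g)) y" if "g \<in> I" for g
        unfolding H using rady[OF that] y by (subst eval_fps_mult) auto
      then show ?thesis unfolding D1(4) sum_distrib_left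
        by (intro sum.cong) (auto simp: mult_ac)
    qed
    then have "\<bar>poly (map_poly of_int Q) y * (\<Delta> * \<Lambda>) - ?m\<bar> =
        \<bar>\<Sum>g\<in>I. \<mu> g * (eval_fps (H Q g) y - (\<Sum>i\<le>D. y ^ i * fps_nth (H Q g) i))\<bar>"
      unfolding m by (simp add: sum_subtractf right_diff_distrib)
    also have "\<dots> \<le> (\<Sum>g\<in>I. \<bar>of_int (\<mu> g)\<bar> * \<bar>eval_fps (H Q g) y - (\<Sum>i\<le>D. y ^ i * fps_nth (H Q g) i)\<bar>)"
      unfolding abs_mult[symmetric] by (rule sum_abs)
    also have "\<dots> \<le> (\<Sum>g\<in>I. (X * z ^ E) * (K Q g * y ^ (D + \<sigma>)))"
      using D1(3) K[OF _ Q(1), of _ y] y X z2 by (intro sum_mono mult_mono) auto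
    also have "\<dots> = (X * z ^ E) * ((\<Sum>g\<in>I. K Q g) * y ^ (D + \<sigma>))"
      by (simp add: sum_distrib_left sum_distrib_right)
    also have "\<dots> \<le> (X * z ^ E) * (T * y ^ (D + \<sigma>))"
      using TQ[OF Q(1)] X z2 y by (intro mult_left_mono mult_right_mono) auto
    also have "\<dots> = (X * T * y) * y ^ D * (z ^ E * y ^ E)"
      by (simp add: \<sigma>_def power_add mult_ac)
    also have "z ^ E * y ^ E = 1" using z2 by (simp add: y_def power_one_over)
    also have "X * T * y * y ^ D * 1 \<le> 1 / 2 * y ^ D"
    proof -
      have "2 * (X * T) \<le> z" using n by (simp add: W_def z_def mult_ac)
      then have "X * T * y \<le> 1 / 2" using z2 by (simp add: y_def field_simps)
      then show ?thesis using y by (simp add: mult_right_mono)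
    qed
    finally have rem: "\<bar>poly (map_poly of_int Q) y * (\<Delta> * \<Lambda>) - ?m\<bar> \<le> 1 / 2 * y ^ D" .
    have "y ^ D \<le> \<bar>?m\<bar>"
      using int1 z2 by (simp add: y_def power_one_over abs_mult field_simps)
    then have low: "1 / 2 * y ^ D \<le> \<bar>poly (map_poly of_int Q) y * (\<Delta> * \<Lambda>)\<bar>" using rem by linarith
    have "\<bar>poly (map_poly of_int Q) y\<bar> \<le> N"
      using abs_poly_le_coeff_length[of y Q] N0[OF Q(1)] y by (simp add: N_def)
    then have "\<bar>poly (map_poly of_int Q) y * (\<Delta> * \<Lambda>)\<bar> \<le> N * (z ^ E * \<bar>\<Lambda>\<bar>)"
      unfolding abs_mult using D1(2) N by (intro mult_mono) auto
    with low have "1 / 2 * y ^ D \<le> N * (z ^ E * \<bar>\<Lambda>\<bar>)" by linarith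
    then have "1 \<le> \<bar>\<Lambda>\<bar> * (2 * N * z ^ (E + D))"
      using z2 by (simp add: y_def power_one_over power_add field_simps)
    also have "\<dots> \<le> \<bar>\<Lambda>\<bar> * (2 * N * (real b * W ^ k) ^ (E + D))"
      using z_up z2 N by (intro mult_left_mono power_mono) auto
    also have "\<dots> = \<bar>\<Lambda>\<bar> * (C * X ^ (k * (E + D)))"
      by (simp add: C_def W_def power_mult_distrib power_mult mult_ac)
    finally show "1 \<le> \<bar>\<Lambda>\<bar> * (C * X ^ (k * (E + D)))" .
  qed
qed

section \<open>From a lower bound for approximations to a finite irrationality exponent\<close>

text \<open>An exponent above \<kappa> + 1 forces q <= C, and then the distance bound 1 leaves
  finitely many p. The value minus infinity must be excluded as well; the exponent -1 always has
  infinitely many solutions.\<close>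

lemma irrationality_exponent_finite:
  fixes \<xi> C :: real and \<kappa> :: nat
  assumes C: "C > 0"
    and bound: "\<And>(p::int) (q::nat). q > 0 \<Longrightarrow> 0 < \<bar>\<xi> - of_int p / of_nat q\<bar> \<Longrightarrow> \<bar>\<xi> - of_int p / of_nat q\<bar> < 1 \<Longrightarrow>
       1 \<le> \<bar>\<xi> - of_int p / of_nat q\<bar> * (C * of_nat q ^ \<kappa>)"
  shows "\<bar>irrationality_exponent \<xi>\<bar> \<noteq> \<infinity>"
proof -
  define S where "S = (\<lambda>\<mu>. {(p :: int, q :: nat). q > 0 \<and>
        0 < \<bar>\<xi> - of_int p / of_nat q\<bar> \<and> \<bar>\<xi> - of_int p / of_nat q\<bar> < of_nat q powr (- \<mu>)})"
  have irr: "irrationality_exponent \<xi> = (SUP \<mu> \<in> {\<mu>. infinite (S \<mu>)}. ereal \<mu>)"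
    by (simp add: irrationality_exponent_def S_def)
  have "\<mu> \<le> real \<kappa> + 1" if inf: "infinite (S \<mu>)" for \<mu>
  proof (rule ccontr)
    assume "\<not> \<mu> \<le> real \<kappa> + 1"
    then have \<mu>: "\<mu> > real \<kappa> + 1" by simp
    have "S \<mu> \<subseteq> {- \<lceil>C * (\<bar>\<xi>\<bar> + 1)\<rceil>..\<lceil>C * (\<bar>\<xi>\<bar> + 1)\<rceil>} \<times> {..nat \<lceil>C\<rceil>}"
    proof (rule subrelI)
      fix p q
      assume "(p, q) \<in> S \<mu>"
      then have q: "q > 0" and pos: "0 < \<bar>\<xi> - of_int p / of_nat q\<bar>"
        and less: "\<bar>\<xi> - of_int p / of_nat q\<bar> < of_nat q powr (- \<mu>)" by (auto simp: S_def)
      have q1: "real q \<ge> 1" using q by simp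
      have "real q powr (- \<mu>) \<le> real q powr (- (real \<kappa> + 1))"
        using q1 \<mu> by (intro powr_mono) auto
      also have "\<dots> = real q powr (- real (\<kappa> + 1))" by (simp add: add.commute)
      also have "\<dots> = 1 / real q ^ (\<kappa> + 1)"
        using q by (simp only: powr_minus powr_realpow of_nat_0_less_iff divide_inverse mult_1)
      finally have le: "\<bar>\<xi> - of_int p / of_nat q\<bar> < 1 / real q ^ (\<kappa> + 1)" using less by simp
      also have "\<dots> \<le> 1" using q1 one_le_power[OF q1, of "\<kappa> + 1"] by simp
      finally have lt1: "\<bar>\<xi> - of_int p / of_nat q\<bar> < 1" .
      have "1 \<le> \<bar>\<xi> - of_int p / of_nat q\<bar> * (C * real q ^ \<kappa>)"
        by (rule bound[OF q pos lt1])
      also have "\<dots> \<le> 1 / real q ^ (\<kappa> + 1) * (C * real q ^ \<kappa>)"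
        using le C by (intro mult_right_mono) auto
      also have "\<dots> = C / real q" using q by simp
      finally have qC: "real q \<le> C" using q by (simp add: field_simps)
      have "\<bar>of_int p / real q\<bar> \<le> \<bar>\<xi>\<bar> + 1" using lt1 by linarith
      then have "\<bar>of_int p\<bar> \<le> real q * (\<bar>\<xi>\<bar> + 1)" using q by (simp add: field_simps abs_divide)
      also have "\<dots> \<le> C * (\<bar>\<xi>\<bar> + 1)" using qC by (intro mult_right_mono) auto
      finally have "\<bar>real_of_int p\<bar> \<le> C * (\<bar>\<xi>\<bar> + 1)" .
      then have "p \<in> {- \<lceil>C * (\<bar>\<xi>\<bar> + 1)\<rceil>..\<lceil>C * (\<bar>\<xi>\<bar> + 1)\<rceil>}"
        by (simp add: abs_le_iff) linarith
      moreover have "q \<le> nat \<lceil>C\<rceil>" using qC by linarith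
      ultimately show "(p, q) \<in> {- \<lceil>C * (\<bar>\<xi>\<bar> + 1)\<rceil>..\<lceil>C * (\<bar>\<xi>\<bar> + 1)\<rceil>} \<times> {..nat \<lceil>C\<rceil>}"
        by simp
    qed
    then have "finite (S \<mu>)" by (rule finite_subset) simp
    with inf show False by simp
  qed
  then have up: "irrationality_exponent \<xi> \<le> ereal (real \<kappa> + 1)"
    unfolding irr by (intro SUP_least) auto
  have "infinite (S (-1))"
  proof (rule infinite_super)
    \<comment> \<open>The fraction is the integer \<open>\<lfloor>\<xi>\<rfloor> + 2\<close>, at
      distance more than 1 and at most 2 from \<open>\<xi>\<close>. Since fractions need not be
      reduced, different \<open>q\<close> give different solutions.\<close>
    show "(\<lambda>q. (int q * (\<lfloor>\<xi>\<rfloor> + 2), q)) ` {3..} \<subseteq> S (-1)"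
    proof clarify
      fix q :: nat assume q: "q \<ge> 3"
      have "real_of_int (int q * (\<lfloor>\<xi>\<rfloor> + 2)) / real q = of_int \<lfloor>\<xi>\<rfloor> + 2" using q by simp
      moreover have "0 < \<bar>\<xi> - (of_int \<lfloor>\<xi>\<rfloor> + 2)\<bar>" "\<bar>\<xi> - (of_int \<lfloor>\<xi>\<rfloor> + 2)\<bar> < real q"
        using q by linarith+
      ultimately show "(int q * (\<lfloor>\<xi>\<rfloor> + 2), q) \<in> S (-1)"
        using q unfolding S_def by simp
    qed
    have "inj_on (\<lambda>q. (int q * (\<lfloor>\<xi>\<rfloor> + 2), q)) {3::nat..}" by (auto simp: inj_on_def)
    then show "infinite ((\<lambda>q. (int q * (\<lfloor>\<xi>\<rfloor> + 2), q)) ` {3::nat..})"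
      using finite_imageD infinite_Ici by blast
  qed
  then have "ereal (-1) \<le> irrationality_exponent \<xi>"
    unfolding irr by (intro SUP_upper) simp
  with up show ?thesis by auto
qed

section \<open>Powers of the Euler operator\<close>

text \<open>This is (x d/dx)^g, written on coefficients. As 0^0 = 1, the case \<open>g = 0\<close>
  is the identity, constant term included.\<close>

definition euler_power :: "nat \<Rightarrow> 'a::comm_ring_1 fps \<Rightarrow> 'a fps" where
  "euler_power g F = Abs_fps (\<lambda>n. of_nat n ^ g * fps_nth F n)"

definition poly_euler_power :: "nat \<Rightarrow> 'a::comm_ring_1 poly \<Rightarrow> 'a poly" where
  "poly_euler_power g p = Abs_poly (\<lambda>n. if n \<le> degree p then of_nat n ^ g * coeff p n else 0)"

lemma euler_power_nth [simp]: "fps_nth (euler_power g F) n = of_nat n ^ g * fps_nth F n"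
  by (simp add: euler_power_def)

lemma coeff_poly_euler_power [simp]: "coeff (poly_euler_power g p) n = of_nat n ^ g * coeff p n"
  by (simp add: poly_euler_power_def coeff_Abs_poly_If_le coeff_eq_0)

lemma fps_of_poly_euler_power: "fps_of_poly (poly_euler_power g p) = euler_power g (fps_of_poly p)"
  by (rule fps_ext) simp

lemma euler_power_sum: "euler_power g (\<Sum>i\<in>A. f i) = (\<Sum>i\<in>A. euler_power g (f i))"
  by (rule fps_ext) (simp add: fps_sum_nth sum_distrib_left)

lemma real_fps_euler_power: "real_fps (euler_power g F) = euler_power g (real_fps F)"
  by (rule fps_ext) simp

text \<open>Leibniz rule: in the convolution, n^h = (i + (n - i))^h is expanded by the binomial
  theorem.\<close>

lemma euler_power_mult:
  "euler_power h (f * F) = (\<Sum>g\<le>h. fps_const (of_nat (h choose g)) * euler_power (h - g) f * euler_power g F)"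
proof (rule fps_ext)
  fix n
  have "fps_nth (euler_power h (f * F)) n =
      (\<Sum>i=0..n. (\<Sum>g\<le>h. of_nat (h choose g) * of_nat i ^ (h - g) * of_nat (n - i) ^ g) * (fps_nth f i * fps_nth F (n - i)))"
    unfolding euler_power_nth fps_mult_nth sum_distrib_left
  proof (rule sum.cong[OF refl])
    fix i assume "i \<in> {0..n}"
    then have "(of_nat n :: 'a) = of_nat (n - i) + of_nat i" by (simp flip: of_nat_add)
    then have "(of_nat n :: 'a) ^ h = (\<Sum>g\<le>h. of_nat (h choose g) * of_nat (n - i) ^ g * of_nat i ^ (h - g))"
      by (simp only: binomial_ring)
    then show "of_nat n ^ h * (fps_nth f i * fps_nth F (n - i)) =
        (\<Sum>g\<le>h. of_nat (h choose g) * of_nat i ^ (h - g) * of_nat (n - i) ^ g) * (fps_nth f i * fps_nth F (n - i))"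
      by (simp add: mult_ac)
  qed
  also have "\<dots> = (\<Sum>g\<le>h. of_nat (h choose g) * (\<Sum>i=0..n. (of_nat i ^ (h - g) * fps_nth f i) * (of_nat (n - i) ^ g * fps_nth F (n - i))))"
    unfolding sum_distrib_right sum_distrib_left by (subst sum.swap) (simp add: mult_ac)
  also have "\<dots> = fps_nth (\<Sum>g\<le>h. fps_const (of_nat (h choose g)) * euler_power (h - g) f * euler_power g F) n"
    by (simp add: fps_sum_nth mult.assoc) (simp add: fps_mult_nth mult.assoc)
  finally show "fps_nth (euler_power h (f * F)) n = \<dots>" .
qed

text \<open>The chain rule produces only a constant and no power of x, which is the advantage over
  d/dx: derivatives of a Mahler equation keep its shape.\<close>

lemma euler_power_compose_X_power:
  assumes "m > 0"
  shows "euler_power g (fps_compose F (fps_X ^ m)) = fps_const (of_nat (m ^ g)) * fps_compose (euler_power g F) (fps_X ^ m)"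
  using assms by (intro fps_ext) (auto simp: fps_compose_X_power_nth power_mult_distrib elim!: dvdE)

lemma fps_compose_X_power_X_power:
  fixes F :: "'a::comm_ring_1 fps"
  assumes "m > 0" "l > 0"
  shows "fps_compose (fps_compose F (fps_X ^ m)) (fps_X ^ l) = fps_compose F (fps_X ^ (m * l))"
  using assms by (intro fps_ext) (auto simp: fps_compose_X_power_nth elim!: dvdE)

lemma less_fps_conv_radius_euler_power:
  fixes F :: "real fps"
  assumes "r < fps_conv_radius F" "r < \<infinity>"
  shows "r < fps_conv_radius (euler_power g F)"
proof (induction g)
  case 0
  have "euler_power 0 F = F" by (rule fps_ext) simp
  then show ?case using assms by simp
next
  case (Suc g)
  have "euler_power (Suc g) F = fps_X * fps_deriv (euler_power g F)"
    by (rule fps_ext) (simp add: fps_X_mult_nth)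
  moreover have "r < fps_conv_radius (fps_deriv (euler_power g F))"
    using fps_conv_radius_deriv[of "euler_power g F"] Suc by (rule less_le_trans[rotated])
  ultimately show ?case using assms(2) by (auto intro: less_fps_conv_radius_mult)
qed

text \<open>The values \<open>\<Sum>n. f n * (coeff p n * y ^ n)\<close> with \<open>f\<close> a monomial are the values at \<open>y\<close> of the
  Euler derivatives; a Lagrange polynomial \<open>f\<close> isolates the leading coefficient.\<close>

lemma some_euler_power_nonzero:
  fixes p :: "int poly" and y :: real
  assumes "p \<noteq> 0" "y \<noteq> 0"
  shows "\<exists>s. poly (map_poly of_int (poly_euler_power s p)) y \<noteq> 0"
proof (rule ccontr)
  assume "\<not> ?thesis"
  then have z: "poly (map_poly of_int (poly_euler_power s p)) y = 0" for s by blast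
  have z': "(\<Sum>n\<le>degree p. real n ^ s * (of_int (coeff p n) * y ^ n)) = 0" for s
  proof -
    have deg: "degree (map_poly real_of_int (poly_euler_power s p)) \<le> degree p"
      by (rule degree_le) (simp add: coeff_map_poly coeff_eq_0)
    have "poly (map_poly of_int (poly_euler_power s p)) y =
        (\<Sum>n\<le>degree p. coeff (map_poly real_of_int (poly_euler_power s p)) n * y ^ n)"
      unfolding poly_altdef using deg
      by (intro sum.mono_neutral_left) (auto simp: coeff_eq_0)
    then show ?thesis using z[of s] by (simp add: coeff_map_poly mult.assoc)
  qed
  define f :: "real poly" where "f = (\<Prod>j<degree p. [:- real j, 1:])"
  have f: "poly f (real n) = (\<Prod>j<degree p. real n - real j)" for n
    by (simp add: f_def poly_prod)
  have "(\<Sum>n\<le>degree p. poly f (real n) * (of_int (coeff p n) * y ^ n)) =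
      (\<Sum>s\<le>degree f. coeff f s * (\<Sum>n\<le>degree p. real n ^ s * (of_int (coeff p n) * y ^ n)))"
    unfolding poly_altdef sum_distrib_right sum_distrib_left by (subst sum.swap) (simp add: mult_ac)
  also have "\<dots> = 0" by (simp only: z') simp
  finally have "(\<Sum>n\<le>degree p. poly f (real n) * (of_int (coeff p n) * y ^ n)) = 0" .
  moreover have "poly f (real n) = 0" if "n < degree p" for n
    using that by (auto simp: f)
  ultimately have "poly f (real (degree p)) * (of_int (lead_coeff p) * y ^ degree p) = 0"
    by (subst (asm) lessThan_Suc_atMost[symmetric]) simp
  moreover have "poly f (real (degree p)) \<noteq> 0" by (auto simp: f)
  ultimately show False using assms by simp
qed

section \<open>Modules over integer polynomials and the differentiated Mahler equation\<close>

text \<open>As a set it allows the rows of a Mahler system to be found by closure properties; a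
  coefficient matrix is extracted only at the end.\<close>

definition poly_span :: "'u set \<Rightarrow> ('u \<Rightarrow> int fps) \<Rightarrow> int fps set" where
  "poly_span U v = {\<Sum>u\<in>U. fps_of_poly (P u) * v u | P. True}"

lemma poly_spanI: "(\<Sum>u\<in>U. fps_of_poly (P u) * v u) \<in> poly_span U v"
  unfolding poly_span_def by blast

lemma poly_span_add:
  assumes "x \<in> poly_span U v" "y \<in> poly_span U v"
  shows "x + y \<in> poly_span U v"
proof -
  obtain P Q where "x = (\<Sum>u\<in>U. fps_of_poly (P u) * v u)" "y = (\<Sum>u\<in>U. fps_of_poly (Q u) * v u)"
    using assms by (auto simp: poly_span_def)
  then have "x + y = (\<Sum>u\<in>U. fps_of_poly (P u + Q u) * v u)"
    by (simp add: fps_of_poly_add distrib_right sum.distrib)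
  then show ?thesis using poly_spanI[of "\<lambda>u. P u + Q u" v U] by simp
qed

lemma poly_span_scale:
  assumes "x \<in> poly_span U v"
  shows "fps_of_poly p * x \<in> poly_span U v"
proof -
  obtain P where "x = (\<Sum>u\<in>U. fps_of_poly (P u) * v u)"
    using assms by (auto simp: poly_span_def)
  then have "fps_of_poly p * x = (\<Sum>u\<in>U. fps_of_poly (p * P u) * v u)"
    by (simp add: fps_of_poly_mult sum_distrib_left mult.assoc)
  then show ?thesis using poly_spanI[of "\<lambda>u. p * P u" v U] by simp
qed

lemma poly_span_zero: "0 \<in> poly_span U v"
  using poly_spanI[of "\<lambda>_. 0" v U] by simp

lemma poly_span_uminus:
  assumes "x \<in> poly_span U v"
  shows "- x \<in> poly_span U v"
  using poly_span_scale[OF assms, of "-1"] by (simp add: fps_of_poly_uminus)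

lemma poly_span_base:
  assumes "finite U" "u \<in> U"
  shows "v u \<in> poly_span U v"
proof -
  have "(\<Sum>w\<in>U. fps_of_poly (if w = u then 1 else 0) * v w) = (\<Sum>w\<in>U. if w = u then v u else 0)"
    by (intro sum.cong) auto
  also have "\<dots> = v u" using assms by simp
  finally show ?thesis using poly_spanI[of "\<lambda>w. if w = u then 1 else 0" v U] by simp
qed

lemma poly_span_sum:
  assumes "\<And>i. i \<in> A \<Longrightarrow> f i \<in> poly_span U v"
  shows "(\<Sum>i\<in>A. f i) \<in> poly_span U v"
  using assms
  by (induction A rule: infinite_finite_induct) (simp_all add: poly_span_zero poly_span_add)

text \<open>The binomial coefficient and the derivative of \<open>a i\<close> come from the Leibniz
  rule, the factor \<open>(k ^ i) ^ g\<close> from the chain rule.\<close>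

lemma mahler_equation_euler_power:
  fixes a :: "nat \<Rightarrow> int poly" and F :: "int fps"
  assumes k: "k > 0" and fe: "(\<Sum>i=0..d. fps_of_poly (a i) * fps_compose F (fps_X ^ (k ^ i))) = 0"
  shows "(\<Sum>i=0..d. \<Sum>g\<le>h. fps_of_poly (smult (of_nat ((h choose g) * (k ^ i) ^ g)) (poly_euler_power (h - g) (a i))) *
     fps_compose (euler_power g F) (fps_X ^ (k ^ i))) = 0"
proof -
  have "0 = euler_power h (\<Sum>i=0..d. fps_of_poly (a i) * fps_compose F (fps_X ^ (k ^ i)))"
    unfolding fe by (rule fps_ext) simp
  also have "\<dots> = (\<Sum>i=0..d. \<Sum>g\<le>h. fps_of_poly (smult (of_nat ((h choose g) * (k ^ i) ^ g)) (poly_euler_power (h - g) (a i))) *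
     fps_compose (euler_power g F) (fps_X ^ (k ^ i)))"
    unfolding euler_power_sum euler_power_mult
  proof (intro sum.cong refl)
    fix i g
    have "euler_power g (fps_compose F (fps_X ^ (k ^ i))) =
        fps_const (of_nat ((k ^ i) ^ g)) * fps_compose (euler_power g F) (fps_X ^ (k ^ i))"
      by (rule euler_power_compose_X_power) (use k in simp)
    then show "fps_const (of_nat (h choose g)) * euler_power (h - g) (fps_of_poly (a i)) *
          euler_power g (fps_compose F (fps_X ^ (k ^ i))) =
        fps_of_poly (smult (of_nat ((h choose g) * (k ^ i) ^ g)) (poly_euler_power (h - g) (a i))) *
          fps_compose (euler_power g F) (fps_X ^ (k ^ i))"
      by (simp add: fps_of_poly_smult fps_of_poly_euler_power fps_const_mult[symmetric] mult_ac del: fps_const_mult)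
  qed
  finally show ?thesis by simp
qed

text \<open>The unsubstituted part of the h-th differentiated equation is \<open>a 0\<close> times
  the h-th derivative plus lower derivatives. Removing these by induction costs up to
  \<open>h\<close> further factors \<open>a 0\<close>, whence the exponent
  \<open>Suc h\<close>.\<close>

lemma euler_power_in_poly_span:
  fixes a :: "nat \<Rightarrow> int poly" and F :: "int fps"
  assumes k: "k > 0" and fe: "(\<Sum>i=0..d. fps_of_poly (a i) * fps_compose F (fps_X ^ (k ^ i))) = 0"
    and "h \<le> H"
  shows "fps_of_poly (a 0 ^ Suc h) * euler_power h F \<in>
    poly_span ({1..d} \<times> {..H}) (\<lambda>(i, g). fps_compose (euler_power g F) (fps_X ^ (k ^ i)))"
    (is "_ \<in> poly_span ?U ?v")
  using \<open>h \<le> H\<close>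
proof (induction h rule: less_induct)
  case (less h)
  define c where "c = (\<lambda>i g. smult (of_nat ((h choose g) * (k ^ i) ^ g)) (poly_euler_power (h - g) (a i)))"
  have grp: "y = - (x + z)" if "0 = x + y + z" for x y z :: "int fps"
    using that by (metis add.commute add.left_commute eq_neg_iff_add_eq_0)
  have c0h: "c 0 h = a 0"
  proof -
    have "poly_euler_power 0 (a 0) = a 0" by (rule poly_eqI) simp
    then show ?thesis by (simp add: c_def)
  qed
  have "0 = (\<Sum>i=0..d. \<Sum>g\<le>h. fps_of_poly (c i g) * fps_compose (euler_power g F) (fps_X ^ (k ^ i)))"
    using mahler_equation_euler_power[OF k fe, of h] by (simp only: c_def)
  also have "\<dots> = (\<Sum>g\<le>h. fps_of_poly (c 0 g) * euler_power g F) +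
      (\<Sum>i=1..d. \<Sum>g\<le>h. fps_of_poly (c i g) * ?v (i, g))"
    by (simp add: sum.atLeast_Suc_atMost)
  also have "(\<Sum>g\<le>h. fps_of_poly (c 0 g) * euler_power g F) =
      (\<Sum>g<h. fps_of_poly (c 0 g) * euler_power g F) + fps_of_poly (a 0) * euler_power h F"
    unfolding lessThan_Suc_atMost[symmetric] by (simp add: c0h)
  finally have eq: "fps_of_poly (a 0) * euler_power h F =
     - ((\<Sum>g<h. fps_of_poly (c 0 g) * euler_power g F) + (\<Sum>i=1..d. \<Sum>g\<le>h. fps_of_poly (c i g) * ?v (i, g)))"
    by (rule grp)
  have "fps_of_poly (a 0 ^ Suc h) * euler_power h F = fps_of_poly (a 0 ^ h) * (fps_of_poly (a 0) * euler_power h F)"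
    by (simp add: fps_of_poly_mult mult_ac)
  also have "\<dots> = - ((\<Sum>g<h. fps_of_poly (a 0 ^ h) * (fps_of_poly (c 0 g) * euler_power g F)) +
      (\<Sum>i=1..d. \<Sum>g\<le>h. fps_of_poly (a 0 ^ h) * (fps_of_poly (c i g) * ?v (i, g))))"
    unfolding eq by (simp only: mult_minus_right distrib_left sum_distrib_left)
  also have "\<dots> \<in> poly_span ?U ?v"
  proof (intro poly_span_uminus poly_span_add poly_span_sum)
    fix g assume g: "g \<in> {..<h}"
    then have "a 0 ^ h = a 0 ^ (h - Suc g) * a 0 ^ Suc g" by (simp flip: power_add power_Suc)
    then have "fps_of_poly (a 0 ^ h) * (fps_of_poly (c 0 g) * euler_power g F) =
        fps_of_poly (a 0 ^ (h - Suc g) * c 0 g) * (fps_of_poly (a 0 ^ Suc g) * euler_power g F)"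
      by (simp only: fps_of_poly_mult mult_ac)
    also have "\<dots> \<in> poly_span ?U ?v"
      by (rule poly_span_scale, rule less.IH) (use less.prems g in auto)
    finally show "fps_of_poly (a 0 ^ h) * (fps_of_poly (c 0 g) * euler_power g F) \<in> poly_span ?U ?v" .
  next
    fix i g assume "i \<in> {1..d}" "g \<in> {..h}"
    then show "fps_of_poly (a 0 ^ h) * (fps_of_poly (c i g) * ?v (i, g)) \<in> poly_span ?U ?v"
      using less.prems by (intro poly_span_scale poly_span_base) auto
  qed
  finally show ?case .
qed

section \<open>Moving the value of F along the orbit past zeros of the leading coefficient\<close>

lemma common_denominator:
  fixes r :: "'a \<Rightarrow> rat"
  assumes "finite A"
  shows "\<exists>D::int. D > 0 \<and> (\<forall>x\<in>A. \<exists>c::int. of_int D * r x = of_int c)"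
  using assms
proof (induction A rule: finite_induct)
  case empty
  then show ?case by (intro exI[of _ 1]) simp
next
  case (insert x A)
  then obtain D :: int where D: "D > 0" "\<forall>x\<in>A. \<exists>c::int. of_int D * r x = of_int c" by blast
  obtain p q where pq: "quotient_of (r x) = (p, q)" by fastforce
  then have q: "q > 0" "r x = of_int p / of_int q"
    by (auto simp: quotient_of_denom_pos quotient_of_div)
  show ?case
  proof (rule exI[of _ "D * q"], intro conjI ballI)
    show "D * q > 0" using D q by simp
    fix z assume z: "z \<in> insert x A"
    show "\<exists>c::int. of_int (D * q) * r z = of_int c"
    proof (cases "z = x")
      case True
      then show ?thesis using q by (intro exI[of _ "D * p"]) simp
    next
      case False
      then obtain c :: int where "of_int D * r z = of_int c" using D z by blast
      then have "of_int (D * q) * r z = of_int (c * q)" by (simp add: mult_ac)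
      then show ?thesis by blast
    qed
  qed
qed

lemma poly_of_int_poly_in_Rats:
  assumes "y \<in> \<rat>"
  shows "poly (map_poly real_of_int p) y \<in> \<rat>"
  unfolding poly_altdef using assms by (auto simp: coeff_map_poly intro!: Rats_sum Rats_mult Rats_power)

text \<open>When \<open>a 0\<close> vanishes at \<open>b ^ -(k ^ n)\<close> to order \<open>s\<close> with respect to the Euler operator, the equation
  differentiated \<open>s + h\<close> times still expresses the value of the \<open>h\<close>-th Euler derivative of \<open>F\<close>
  at that point by values at later points of the orbit.\<close>

lemma mahler_value_shift:
  fixes a :: "nat \<Rightarrow> int poly" and F :: "int fps" and k b d :: nat
  assumes k: "k \<ge> 2" and b: "b \<ge> 2"
    and fe: "(\<Sum>i=0..d. fps_of_poly (a i) * fps_compose F (fps_X ^ (k ^ i))) = 0"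
    and a0: "a 0 \<noteq> 0"
    and rad: "ereal (1 / real b) < fps_conv_radius (real_fps F)"
  defines "val \<equiv> (\<lambda>(g, m). eval_fps (real_fps (euler_power g F)) (1 / real (b ^ k ^ m)))"
  shows "\<exists>U D c. finite U \<and> (\<forall>(g, m)\<in>U. m \<ge> N) \<and> D > 0 \<and>
    of_int D * val (0, 0) = (\<Sum>u\<in>U. of_int (c u :: int) * val u)"
proof -
  interpret V: vector_space "\<lambda>q x. of_rat q * x :: real"
    by unfold_locales (simp_all add: of_rat_add of_rat_mult algebra_simps)
  define x where "x = (\<lambda>m. 1 / real (b ^ k ^ m))"
  \<comment> \<open>The rational span of all derivative values from orbit index \<open>n\<close> on.
    It suffices to show that discarding index \<open>n\<close> loses nothing.\<close>
  define A where "A = (\<lambda>n. V.span (val ` {(g, m). m \<ge> n}))"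
  have A_scale: "r * v \<in> A n" if "r \<in> \<rat>" "v \<in> A n" for r v n
    using that V.span_scale unfolding A_def by (auto elim!: Rats_cases)
  have x: "0 < x m" "x m < 1" "x m \<le> 1 / real b" "x m \<in> \<rat>" for m
  proof -
    have "b ^ 1 \<le> b ^ k ^ m" using k b by (intro power_increasing) auto
    then have "real b \<le> real (b ^ k ^ m)" by simp
    then show "0 < x m" "x m < 1" "x m \<le> 1 / real b" "x m \<in> \<rat>" using b
      by (auto simp: x_def frac_le simp del: of_nat_power)
  qed
  have radx: "ereal (x m) < fps_conv_radius (real_fps (euler_power g F))" for m g
  proof -
    have "ereal (1 / real b) < fps_conv_radius (real_fps (euler_power g F))"
      unfolding real_fps_euler_power using rad by (intro less_fps_conv_radius_euler_power) auto
    then show ?thesis using less_fps_conv_radius_le[OF less_imp_le[OF x(1)] x(3)]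
      by (simp add: abs_of_pos[OF x(1)])
  qed
  define c where "c = (\<lambda>h i g. smult (of_nat ((h choose g) * (k ^ i) ^ g)) (poly_euler_power (h - g) (a i)))"
  have num: "(\<Sum>i=0..d. \<Sum>g\<le>h. poly (map_poly of_int (c h i g)) (x n) * val (g, n + i)) = 0" for n h
  proof -
    have k0: "k ^ i > 0" for i using k by simp
    have "(\<Sum>i=0..d. \<Sum>g\<le>h. fps_of_poly (c h i g) * fps_compose (euler_power g F) (fps_X ^ (k ^ i))) = 0"
      unfolding c_def by (rule mahler_equation_euler_power[OF _ fe]) (use k in simp)
    then have "real_fps (\<Sum>i=0..d. \<Sum>g\<le>h. fps_of_poly (c h i g) * fps_compose (euler_power g F) (fps_X ^ (k ^ i))) = real_fps 0"
      by (rule arg_cong)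
    then have eq: "(\<Sum>i=0..d. \<Sum>g\<le>h. fps_of_poly (map_poly of_int (c h i g)) *
        fps_compose (real_fps (euler_power g F)) (fps_X ^ (k ^ i))) = real_fps 0"
      by (simp add: real_fps_mult real_fps_sum real_fps_of_poly real_fps_compose_X_power[OF k0])
    have zero: "eval_fps (real_fps 0) (x n) = 0"
      by (simp add: eval_fps_def)
    have nx: "ereal (norm (x n)) = ereal (x n)" using x(1)[of n] by simp
    have xk: "x n ^ (k ^ i) = x (n + i)" for i
      by (simp add: x_def power_one_over power_add flip: power_mult)
    have cmp1: "ereal (x n) < fps_conv_radius (fps_compose (real_fps (euler_power g F)) (fps_X ^ (k ^ i)))" for g i
      by (rule fps_compose_X_power_eval(1)[OF k0 x(1,2) radx])
    have cmp2: "eval_fps (fps_compose (real_fps (euler_power g F)) (fps_X ^ (k ^ i))) (x n) = val (g, n + i)" for g i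
      unfolding fps_compose_X_power_eval(2)[OF k0 x(1,2) radx] xk by (simp add: val_def x_def)
    have r1: "ereal (norm (x n)) < fps_conv_radius (fps_of_poly (map_poly of_int (c h i g)) *
        fps_compose (real_fps (euler_power g F)) (fps_X ^ (k ^ i)))" for i g
      unfolding nx by (intro less_fps_conv_radius_mult cmp1) simp
    have "eval_fps (\<Sum>i=0..d. \<Sum>g\<le>h. fps_of_poly (map_poly of_int (c h i g)) *
        fps_compose (real_fps (euler_power g F)) (fps_X ^ (k ^ i))) (x n) =
      (\<Sum>i=0..d. \<Sum>g\<le>h. eval_fps (fps_of_poly (map_poly of_int (c h i g)) *
        fps_compose (real_fps (euler_power g F)) (fps_X ^ (k ^ i))) (x n))"
      by (subst eval_fps_sum) (use r1 in \<open>auto intro!: less_fps_conv_radius_sum simp: eval_fps_sum\<close>)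
    also have "\<dots> = (\<Sum>i=0..d. \<Sum>g\<le>h. poly (map_poly of_int (c h i g)) (x n) * val (g, n + i))"
    proof (intro sum.cong refl)
      fix i g
      show "eval_fps (fps_of_poly (map_poly of_int (c h i g)) *
        fps_compose (real_fps (euler_power g F)) (fps_X ^ (k ^ i))) (x n) =
        poly (map_poly of_int (c h i g)) (x n) * val (g, n + i)"
        by (subst eval_fps_mult) (simp_all only: nx cmp1 cmp2 eval_fps_of_poly fps_conv_radius_fps_of_poly less_ereal.simps)
    qed
    finally show ?thesis unfolding eq zero by simp
  qed
  have step: "val (h, n) \<in> A (Suc n)" for h n
  proof -
    define e where "e = (\<lambda>j. poly (map_poly of_int (poly_euler_power j (a 0))) (x n))"
    have "\<exists>s. e s \<noteq> 0" unfolding e_def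
      using x(1)[of n] by (intro some_euler_power_nonzero a0) simp
    define s where "s = (LEAST s. e s \<noteq> 0)"
    have s: "e s \<noteq> 0" unfolding s_def by (rule LeastI_ex) fact
    have s_min: "e j = 0" if "j < s" for j using not_less_Least that unfolding s_def by blast
    have eRat: "e j \<in> \<rat>" for j unfolding e_def by (rule poly_of_int_poly_in_Rats) (rule x)
    have map_smult: "map_poly real_of_int (smult (of_nat m) p) = smult (of_nat m) (map_poly of_int p)" for m p
      by (rule poly_eqI) (simp add: coeff_map_poly)
    show ?thesis
    proof (induction h rule: less_induct)
      case (less h)
      have c0: "poly (map_poly of_int (c (s + h) 0 g)) (x n) = of_nat ((s + h) choose g) * e (s + h - g)" for g
        by (simp only: c_def map_smult poly_smult e_def) simp
      have "0 = (\<Sum>g\<le>s + h. of_nat ((s + h) choose g) * e (s + h - g) * val (g, n)) +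
         (\<Sum>i=1..d. \<Sum>g\<le>s + h. poly (map_poly of_int (c (s + h) i g)) (x n) * val (g, n + i))"
        using num[of "s + h" n] by (simp add: sum.atLeast_Suc_atMost c0)
      \<comment> \<open>For \<open>g > h\<close> fewer than \<open>s\<close> derivatives fall on
        \<open>a 0\<close>, so these terms vanish at \<open>x n\<close>. The h-th derivative is now
        the highest one at this point, and its coefficient
        \<open>of_nat ((s + h) choose h) * e s\<close> is nonzero.\<close>
      also have "(\<Sum>g\<le>s + h. of_nat ((s + h) choose g) * e (s + h - g) * val (g, n)) =
          (\<Sum>g<Suc h. of_nat ((s + h) choose g) * e (s + h - g) * val (g, n))"
        by (rule sum.mono_neutral_right) (auto intro!: s_min)
      finally have eq: "of_nat ((s + h) choose h) * e s * val (h, n) =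
        - ((\<Sum>g<h. of_nat ((s + h) choose g) * e (s + h - g) * val (g, n)) +
         (\<Sum>i=1..d. \<Sum>g\<le>s + h. poly (map_poly of_int (c (s + h) i g)) (x n) * val (g, n + i)))"
        by simp
      also have "\<dots> \<in> A (Suc n)"
      proof -
        have "of_nat ((s + h) choose g) * e (s + h - g) * val (g, n) \<in> A (Suc n)" if "g < h" for g
          using less[OF that] eRat by (intro A_scale Rats_mult) auto
        moreover have "poly (map_poly of_int (c (s + h) i g)) (x n) * val (g, n + i) \<in> A (Suc n)"
          if "i \<in> {1..d}" for i g
        proof (rule A_scale)
          show "val (g, n + i) \<in> A (Suc n)"
            unfolding A_def using that by (intro V.span_base imageI) auto
        qed (intro poly_of_int_poly_in_Rats x)
        ultimately show ?thesis
          unfolding A_def by (intro V.span_neg V.span_add V.span_sum) auto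
      qed
      finally have mem: "of_nat ((s + h) choose h) * e s * val (h, n) \<in> A (Suc n)" .
      have "inverse (of_nat ((s + h) choose h) * e s) * (of_nat ((s + h) choose h) * e s * val (h, n)) \<in> A (Suc n)"
        by (rule A_scale[OF _ mem]) (use eRat in \<open>auto intro!: Rats_inverse Rats_mult\<close>)
      then show ?case using s by (simp add: field_simps)
    qed
  qed
  have "A n \<subseteq> A (Suc n)" for n
  proof -
    have "val ` {(g, m). m \<ge> n} \<subseteq> A (Suc n)"
    proof clarify
      fix g m assume "n \<le> m"
      show "val (g, m) \<in> A (Suc n)"
      proof (cases "m = n")
        case True
        then show ?thesis using step by simp
      next
        case False
        then show ?thesis using \<open>n \<le> m\<close> unfolding A_def by (intro V.span_base imageI) auto
      qed
    qed
    then show ?thesis unfolding A_def by (rule V.span_minimal) (rule V.subspace_span)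
  qed
  then have "A 0 \<subseteq> A N" by (rule lift_Suc_mono_le) simp
  moreover have "val (0, 0) \<in> A 0" unfolding A_def by (intro V.span_base imageI) simp
  ultimately have "val (0, 0) \<in> V.span (val ` {(g, m). m \<ge> N})" unfolding A_def by blast
  then obtain t r where t: "finite t" "t \<subseteq> val ` {(g, m). m \<ge> N}" "val (0, 0) = (\<Sum>v\<in>t. of_rat (r v) * v)"
    unfolding V.span_explicit by blast
  \<comment> \<open>Distinct index pairs may have equal values; choosing one pair per value makes
    the sum over \<open>t\<close> a sum over indices.\<close>
  then obtain U where U: "U \<subseteq> {(g, m). m \<ge> N}" "inj_on val U" "t = val ` U"
    by (auto simp: subset_image_inj)
  have finU: "finite U" using t(1) U finite_imageD by blast
  obtain D :: int where D: "D > 0" "\<forall>u\<in>U. \<exists>c::int. of_int D * r (val u) = of_int c"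
    using common_denominator[OF finU, of "\<lambda>u. r (val u)"] by blast
  then obtain c :: "nat \<times> nat \<Rightarrow> int" where c: "\<And>u. u \<in> U \<Longrightarrow> of_int D * r (val u) = of_int (c u)"
    by metis
  have cr: "of_int D * of_rat (r (val u)) = (of_int (c u) :: real)" if "u \<in> U" for u
    using arg_cong[OF c[OF that], of "of_rat :: rat \<Rightarrow> real"] by (simp add: of_rat_mult)
  have "of_int D * val (0, 0) = (\<Sum>u\<in>U. of_int D * (of_rat (r (val u)) * val u))"
    unfolding t(3) U(3) sum.reindex[OF U(2)] sum_distrib_left by simp
  also have "\<dots> = (\<Sum>u\<in>U. of_int (c u) * val u)"
    by (intro sum.cong refl) (simp add: cr flip: mult.assoc)
  finally show ?thesis using finU U(1) D(1) by blast
qed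

section \<open>The system of Euler derivatives at the shifted base point\<close>

lemma map_poly_of_int_power: "map_poly real_of_int (p ^ n) = map_poly of_int p ^ n"
proof (induction n)
  case (Suc n)
  have "map_poly real_of_int (p * q) = map_poly of_int p * map_poly of_int q" for q
    by (simp add: fps_of_poly_eq_iff[symmetric] real_fps_of_poly[symmetric] fps_of_poly_mult real_fps_mult)
  with Suc show ?case by simp
qed simp

theorem theorem1p1:
  fixes k d b :: nat and a :: "nat \<Rightarrow> int poly" and F :: "int fps"
  assumes "k \<ge> 2" and "d \<ge> 1"
    and "a 0 * a d \<noteq> 0"
    and "(\<Sum>i=0..d. fps_of_poly (a i) * fps_compose F (fps_X ^ (k ^ i))) = 0"
    and "b \<ge> 2"
    and "ereal (1 / real b) < fps_conv_radius (real_fps F)"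
  shows "\<bar>irrationality_exponent (eval_fps (real_fps F) (1 / real b))\<bar> \<noteq> \<infinity> \<and>
         \<not> liouville_number (eval_fps (real_fps F) (1 / real b))"
proof -
  note k = assms(1) and fe = assms(4) and b = assms(5) and rad = assms(6)
  have a0: "a 0 \<noteq> 0" using assms(3) by auto
  have kpos: "k > 0" "k ^ i > 0" for i using k by simp_all
  define x where "x = (\<lambda>m. 1 / real (b ^ k ^ m))"
  define val where "val = (\<lambda>(g, m). eval_fps (real_fps (euler_power g F)) (x m))"
  define \<xi> where "\<xi> = eval_fps (real_fps F) (1 / real b)"
  have x: "0 < x m" "x m < 1" "x m \<le> 1 / real b" for m
  proof -
    have "b ^ 1 \<le> b ^ k ^ m" using k b by (intro power_increasing) auto
    then have "real b \<le> real (b ^ k ^ m)" by simp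
    then show "0 < x m" "x m < 1" "x m \<le> 1 / real b" using b
      by (auto simp: x_def frac_le simp del: of_nat_power)
  qed
  have "inj x"
  proof (rule injI)
    fix m n assume "x m = x n"
    then have "b ^ k ^ m = b ^ k ^ n" by (simp add: x_def flip: of_nat_power)
    then show "m = n" using k b by (simp add: power_inject_exp)
  qed
  have "map_poly real_of_int (a 0) \<noteq> 0" using a0 by (simp add: map_poly_eq_0_iff)
  then have "finite {m. poly (map_poly real_of_int (a 0)) (x m) = 0}"
    using finite_vimageI[OF poly_roots_finite \<open>inj x\<close>, of "map_poly real_of_int (a 0)"]
    by (simp add: vimage_def)
  then obtain N where "\<forall>m\<in>{m. poly (map_poly real_of_int (a 0)) (x m) = 0}. m < N"
    unfolding finite_nat_set_iff_bounded by blast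
  then have N: "poly (map_poly real_of_int (a 0)) (x m) \<noteq> 0" if "m \<ge> N" for m
    using that by force
  obtain U D0 c0 where U: "finite U" "\<forall>(g, m)\<in>U. m \<ge> N" "D0 > 0"
    "of_int D0 * val (0, 0) = (\<Sum>u\<in>U. of_int (c0 u :: int) * val u)"
    using mahler_value_shift[OF k b fe a0 rad, of N] unfolding val_def x_def by blast
  obtain H where H: "\<And>u. u \<in> U \<Longrightarrow> fst u \<le> H" using finite_bounded_nat[OF U(1)] by blast
  obtain E0 where E0: "\<And>u. u \<in> U \<Longrightarrow> snd u \<le> E0" using finite_bounded_nat[OF U(1)] by blast
  \<comment> \<open>Large enough for all orbit indices occurring in \<open>U\<close> and for the
    shifts up to \<open>d - 1\<close> required by the Mahler equation.\<close>
  define E where "E = d + E0 + 1"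
  define J where "J = {..H} \<times> {..<E}"
  define c where "c = (\<lambda>(g, i). if (g, N + i) \<in> U then c0 (g, N + i) else 0)"
  have finJ: "finite J" by (simp add: J_def)
  have xi_eq: "of_int D0 * \<xi> = (\<Sum>(g, i)\<in>J. of_int (c (g, i)) * val (g, N + i))"
  proof -
    have "euler_power 0 F = F" by (rule fps_ext) simp
    then have "val (0, 0) = \<xi>" by (simp add: val_def x_def \<xi>_def)
    moreover have "(\<Sum>u\<in>U. of_int (c0 u) * val u) = (\<Sum>(g, i)\<in>{(g, i)\<in>J. (g, N + i) \<in> U}. of_int (c (g, i)) * val (g, N + i))"
      by (rule sum.reindex_bij_witness[of _ "\<lambda>(g, i). (g, N + i)" "\<lambda>(g, m). (g, m - N)"])
         (use U(2) H E0 in \<open>fastforce simp: c_def J_def E_def\<close>)+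
    moreover have "\<dots> = (\<Sum>(g, i)\<in>J. of_int (c (g, i)) * val (g, N + i))"
      by (rule sum.mono_neutral_left) (use finJ in \<open>auto simp: c_def split: if_splits\<close>)
    ultimately show ?thesis using U(4) by simp
  qed
  \<comment> \<open>\<open>None\<close> indexes the constant series 1, whose coefficient in the
    linear form carries the numerator \<open>p\<close>.\<close>
  define I where "I = insert None (Some ` J)"
  define G where "G = (\<lambda>u. case u of None \<Rightarrow> 1 | Some (g, i) \<Rightarrow> fps_compose (euler_power g F) (fps_X ^ (k ^ i)))"
  have finI: "finite I" using finJ by (simp add: I_def)
  \<comment> \<open>With \<open>B\<close> as base the orbit starts at \<open>x N\<close>, beyond
    every zero of \<open>a 0\<close> on it.\<close>
  define B where "B = b ^ k ^ N"
  have B: "1 / real B = x N" "B \<ge> 2"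
  proof -
    have "b ^ 1 \<le> b ^ k ^ N" using k b by (intro power_increasing) auto
    then show "B \<ge> 2" using b by (simp add: B_def)
  qed (simp add: B_def x_def)
  \<comment> \<open>A common denominator for all derivative orders up to \<open>H\<close>.\<close>
  define \<delta> where "\<delta> = a 0 ^ Suc H"
  define v where "v = (\<lambda>u. fps_compose (G u) (fps_X ^ k))"
  have v_Some: "v (Some (g, i)) = fps_compose (euler_power g F) (fps_X ^ (k ^ Suc i))" for g i
    unfolding v_def G_def using fps_compose_X_power_X_power[OF kpos(2) kpos(1), of "euler_power g F" i]
    by (simp add: mult.commute)
  have sys: "fps_of_poly \<delta> * G u \<in> poly_span I v" if uI: "u \<in> I" for u
  proof (cases u)
    case None
    then have "G u = v None" by (simp add: G_def v_def)
    then show ?thesis using finI by (auto intro!: poly_span_scale poly_span_base simp: I_def)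
  next
    case (Some w)
    then obtain g i where u: "u = Some (g, i)" "g \<le> H" "i < E" using uI by (cases w) (auto simp: I_def J_def)
    show ?thesis
    proof (cases i)
      \<comment> \<open>Only unsubstituted derivatives need the Mahler equation; for positive
        \<open>i\<close>, \<open>G u\<close> is already the image of its predecessor under the
        substitution of x^k.\<close>
      case 0
      have "fps_of_poly (a 0 ^ Suc g) * euler_power g F \<in>
          poly_span ({1..d} \<times> {..H}) (\<lambda>(i, g). fps_compose (euler_power g F) (fps_X ^ (k ^ i)))"
        by (rule euler_power_in_poly_span[OF kpos(1) fe u(2)])
      then obtain P where P: "fps_of_poly (a 0 ^ Suc g) * euler_power g F = (\<Sum>w\<in>{1..d} \<times> {..H}.
          fps_of_poly (P w) * (case w of (i, g) \<Rightarrow> fps_compose (euler_power g F) (fps_X ^ (k ^ i))))"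
        by (auto simp: poly_span_def)
      have "fps_of_poly (a 0 ^ Suc g) * euler_power g F \<in> poly_span I v"
        unfolding P
      proof (intro poly_span_sum poly_span_scale)
        fix w assume w: "w \<in> {1..d} \<times> {..H}"
        obtain j h where jh: "w = (j, h)" by fastforce
        have "(case w of (i, g) \<Rightarrow> fps_compose (euler_power g F) (fps_X ^ (k ^ i))) = v (Some (h, j - 1))"
          using w by (simp add: v_Some jh flip: power_Suc)
        also have "\<dots> \<in> poly_span I v"
          using w finI by (intro poly_span_base) (auto simp: I_def J_def E_def jh)
        finally show "(case w of (i, g) \<Rightarrow> fps_compose (euler_power g F) (fps_X ^ (k ^ i))) \<in> poly_span I v" .
      qed
      then have "fps_of_poly (a 0 ^ (H - g)) * (fps_of_poly (a 0 ^ Suc g) * euler_power g F) \<in> poly_span I v"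
        by (rule poly_span_scale)
      moreover have "a 0 ^ (H - g) * a 0 ^ Suc g = \<delta>"
        using u(2) by (simp add: \<delta>_def flip: power_add power_Suc)
      moreover have "G u = euler_power g F" by (simp add: G_def u 0)
      ultimately show ?thesis by (simp only: mult.assoc[symmetric] fps_of_poly_mult[symmetric])
    next
      case (Suc j)
      then have "G u = v (Some (g, j))" by (simp add: v_Some u G_def)
      then show ?thesis using finI u Suc
        by (auto intro!: poly_span_scale poly_span_base simp: I_def J_def)
    qed
  qed
  have "\<forall>u\<in>I. \<exists>P. fps_of_poly \<delta> * G u = (\<Sum>h\<in>I. fps_of_poly (P h) * v h)"
    using sys unfolding poly_span_def by blast
  then obtain M where M: "\<forall>u\<in>I. fps_of_poly \<delta> * G u = (\<Sum>h\<in>I. fps_of_poly (M u h) * v h)"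
    unfolding bchoice_iff by blast
  have nz: "\<forall>n. poly (map_poly of_int \<delta>) (1 / real (B ^ k ^ n)) \<noteq> 0"
  proof
    fix n
    have "1 / real (B ^ k ^ n) = x (N + n)" by (simp add: B_def x_def power_add flip: power_mult)
    moreover have "map_poly real_of_int \<delta> = map_poly of_int (a 0) ^ Suc H"
      unfolding \<delta>_def by (rule map_poly_of_int_power)
    ultimately show "poly (map_poly of_int \<delta>) (1 / real (B ^ k ^ n)) \<noteq> 0"
      using N[of "N + n"] by (simp only: poly_power power_not_zero le_add1 not_False_eq_True)
  qed
  have radF: "ereal (x m) < fps_conv_radius (real_fps (euler_power g F))" for g m
  proof -
    have "ereal (1 / real b) < fps_conv_radius (real_fps (euler_power g F))"
      unfolding real_fps_euler_power using rad by (intro less_fps_conv_radius_euler_power) auto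
    then show ?thesis using less_fps_conv_radius_le[OF less_imp_le[OF x(1)] x(3)]
      by (simp add: abs_of_pos[OF x(1)])
  qed
  have real1: "real_fps 1 = 1" by (rule fps_ext) simp
  have radG: "\<forall>u\<in>I. ereal (1 / real B) < fps_conv_radius (real_fps (G u))"
    unfolding B(1)
    by (auto simp: I_def G_def real1 real_fps_compose_X_power[OF kpos(2)]
        intro!: fps_compose_X_power_eval(1)[OF kpos(2) x(1,2) radF])
  have evG: "eval_fps (real_fps (G (Some (g, i)))) (1 / real B) = val (g, N + i)" for g i
  proof -
    have "x N ^ k ^ i = x (N + i)" by (simp add: x_def power_one_over power_add flip: power_mult)
    then show ?thesis
      unfolding B(1) G_def option.case prod.case real_fps_compose_X_power[OF kpos(2)]
        fps_compose_X_power_eval(2)[OF kpos(2) x(1,2) radF] by (simp add: val_def)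
  qed
  have ev1: "eval_fps (real_fps (G None)) (1 / real B) = 1" by (simp add: G_def real1)
  obtain C \<kappa> where C: "C > 0"
    and forms: "\<forall>(w::(nat \<times> nat) option \<Rightarrow> int) (X::real) (\<Lambda>::real). X \<ge> 1 \<longrightarrow> (\<forall>g\<in>I. \<bar>of_int (w g)\<bar> \<le> X) \<longrightarrow>
       \<Lambda> = (\<Sum>g\<in>I. w g * eval_fps (real_fps (G g)) (1 / real B)) \<longrightarrow> \<Lambda> \<noteq> 0 \<longrightarrow>
       1 \<le> \<bar>\<Lambda>\<bar> * (C * X ^ \<kappa>)"
    using mahler_system_linear_forms[OF finI k B(2) M[unfolded v_def] nz radG] by blast
  \<comment> \<open>\<open>real q * K\<close> bounds every coefficient of the form: |p| <= q
    (|\<xi>| + 1) for approximations within distance 1, and the remaining coefficients are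
    \<open>q\<close> times entries of \<open>c\<close>.\<close>
  define K where "K = 1 + real_of_int D0 * (\<bar>\<xi>\<bar> + 1) + (\<Sum>u\<in>J. \<bar>of_int (c u)\<bar>)"
  have K: "K \<ge> 1" using U(3) by (auto simp: K_def intro!: add_nonneg_nonneg sum_nonneg)
  have "\<bar>irrationality_exponent \<xi>\<bar> \<noteq> \<infinity>"
  \<comment> \<open>The exponent \<open>Suc \<kappa>\<close> arises because the linear form is
    \<open>D0 * q\<close> times the approximation error, which contributes one further factor
    \<open>q\<close>.\<close>
  proof (rule irrationality_exponent_finite[of "D0 * C * K ^ \<kappa>" \<xi> "Suc \<kappa>"])
    show "0 < D0 * C * K ^ \<kappa>" using U(3) C K by simp
    fix p :: int and q :: nat
    assume q: "q > 0" and pos: "0 < \<bar>\<xi> - of_int p / of_nat q\<bar>" and lt1: "\<bar>\<xi> - of_int p / of_nat q\<bar> < 1"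
    define w where "w = (\<lambda>u. case u of None \<Rightarrow> - D0 * p | Some u \<Rightarrow> int q * c u)"
    define X where "X = real q * K"
    have X: "X \<ge> 1" using mult_mono[of 1 "real q" 1 K] q K by (simp add: X_def)
    have wX: "\<forall>u\<in>I. \<bar>of_int (w u)\<bar> \<le> X"
    proof
      fix u assume u: "u \<in> I"
      show "\<bar>of_int (w u)\<bar> \<le> X"
      proof (cases u)
        case None
        have "\<bar>of_int p / real q\<bar> \<le> \<bar>\<xi>\<bar> + 1" using lt1 by linarith
        then have "\<bar>real_of_int p\<bar> \<le> real q * (\<bar>\<xi>\<bar> + 1)" using q by (simp add: field_simps abs_divide)
        then have "real_of_int D0 * \<bar>of_int p\<bar> \<le> real_of_int D0 * (real q * (\<bar>\<xi>\<bar> + 1))"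
          using U(3) by (intro mult_left_mono) auto
        also have "\<dots> = real q * (real_of_int D0 * (\<bar>\<xi>\<bar> + 1))" by simp
        also have "\<dots> \<le> X" unfolding X_def K_def
          by (intro mult_left_mono) (auto intro: sum_nonneg)
        finally show ?thesis using U(3) by (simp add: w_def None abs_mult)
      next
        case (Some j)
        then have "j \<in> J" using u by (auto simp: I_def)
        then have "\<bar>real_of_int (c j)\<bar> \<le> (\<Sum>u\<in>J. \<bar>of_int (c u)\<bar>)"
          using finJ by (intro member_le_sum) auto
        also have "\<dots> \<le> K" using U(3) by (simp add: K_def)
        finally show ?thesis by (simp add: w_def Some abs_mult X_def mult_left_mono)
      qed
    qed
    define \<Lambda> where "\<Lambda> = real_of_int D0 * real q * (\<xi> - of_int p / real q)"
    have "(\<Sum>u\<in>I. w u * eval_fps (real_fps (G u)) (1 / real B)) =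
        - D0 * p + (\<Sum>u\<in>J. w (Some u) * eval_fps (real_fps (G (Some u))) (1 / real B))"
      using finJ by (auto simp: I_def sum.reindex ev1 w_def)
    also have "(\<Sum>u\<in>J. w (Some u) * eval_fps (real_fps (G (Some u))) (1 / real B)) = real q * (of_int D0 * \<xi>)"
      unfolding xi_eq sum_distrib_left by (intro sum.cong) (auto simp: w_def evG)
    finally have \<Lambda>: "\<Lambda> = (\<Sum>u\<in>I. w u * eval_fps (real_fps (G u)) (1 / real B))"
      using q by (simp add: \<Lambda>_def right_diff_distrib)
    have "\<Lambda> \<noteq> 0" using pos q U(3) by (simp add: \<Lambda>_def)
    then have "1 \<le> \<bar>\<Lambda>\<bar> * (C * X ^ \<kappa>)"
      using forms X wX \<Lambda> by blast
    also have "\<dots> = \<bar>\<xi> - of_int p / of_nat q\<bar> * (D0 * C * K ^ \<kappa> * of_nat q ^ Suc \<kappa>)"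
      using U(3) by (simp add: \<Lambda>_def X_def abs_mult power_mult_distrib mult_ac)
    finally show "1 \<le> \<bar>\<xi> - of_int p / of_nat q\<bar> * (D0 * C * K ^ \<kappa> * of_nat q ^ Suc \<kappa>)" .
  qed
  then show ?thesis unfolding \<xi>_def liouville_number_def by auto
qed

end
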